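(* Let $1\le k\le n-1$, $\alpha,\beta\in\mathbb{C}$, $C\in\mathbb{C}^{(n-k)\times k}$, $D\in\mathbb{C}^{k\times(n-k)}$, and $$A=\begin{bmatrix}\alpha I_{n-k} & C\\ D & \beta I_k\end{bmatrix},\qquad H=C^*C+DD^*,\qquad Z=DC,\qquad \gamma=\frac{\alpha-\beta}{2}.$$ Suppose that $Z$ is normal and commutes with $H$. Then $H$ and $Z$ can be diagonalized by the same unitary similarity; let $h_j$ and $z_j$ ($j=1,\dots,k$) be the eigenvalues of $H$ and $Z$, respectively, labeled according to the order in which they appear on the respective diagonals. Then the numerical range $W(A)$ is the convex hull of at most $k$ ellipses. Moreover, each ellipse associated with a particular $\mu_j(\theta)=h_j-2\operatorname{Re}(e^{-2i\theta}z_j)$ is centered at $(\alpha+\beta)/2$, with a major axis of length $2a_j$ parallel to $e^{-i\phi_j}$ and a minor axis of length $2b_j$, where $$a_j=\left(\frac{|\gamma|^2}{2}+\frac{h_j}{4}+\frac12\left|\gamma^2+z_j\right|\right)^{1/2},\qquad b_j=\left(\frac{|\gamma|^2}{2}+\frac{h_j}{4}-\frac12\left|\gamma^2+z_j\right|\right)^{1/2},$$ and $\phi_j$ is the principal argument of $i\sqrt{\gamma^2+z_j}$.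
   Context: For $A\in\mathbb{C}^{n\times n}$ the numerical range is $W(A)=\{\langle Ax,x\rangle: x\in\mathbb{C}^n,\ \|x\|=1\}\subset\mathbb{C}$, with the standard inner product. For a square matrix $X$, $\operatorname{Re}X=\frac12(X+X^* )$ and $\operatorname{Im}X=\frac1{2i}(X-X^* )$. The functions $\mu_j(\theta)$ are the eigenvalues of $M(\theta)=H-2\operatorname{Re}(e^{-2i\theta}Z)$. The ellipse associated with $\mu_j(\theta)$ is the one whose tangent lines, after translating the center $(\alpha+\beta)/2$ to the origin, correspond to the eigenvalues $\lambda_j(\theta)=\pm\sqrt{(\operatorname{Im}(e^{-i\theta}\gamma))^2+\mu_j(\theta)/4}$ of $\operatorname{Im}\left(e^{-i\theta}\left(A-\frac{\alpha+\beta}{2}I\right)\right)$.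
   Formalization: The major axis is stated parallel to i e^{iφ_j} (that is, to √(γ²+z_j)) instead of e^{-iφ_j}; the latter fails for α=1, β=-1, C=D=0, where W(A)=[-1,1] but e^{-iφ}=-i. *)

theory Defs
  imports "HOL-Analysis.Analysis" "Jordan_Normal_Form.Schur_Decomposition"
begin

text \<open>\<open>(A *\<^sub>v x) \<bullet>c x\<close> is linear in its left argument, and \<open>x \<bullet>c x\<close> is the squared norm of \<open>x\<close>.\<close>

definition numerical_range :: "complex mat \<Rightarrow> complex set" where
  "numerical_range A = {(A *\<^sub>v x) \<bullet>c x | x. x \<in> carrier_vec (dim_col A) \<and> x \<bullet>c x = 1}"

definition re_mat :: "complex mat \<Rightarrow> complex mat" where
  "re_mat X = (1/2) \<cdot>\<^sub>m (X + mat_adjoint X)"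

definition normal_mat :: "complex mat \<Rightarrow> bool" where
  "normal_mat X \<longleftrightarrow> X * mat_adjoint X = mat_adjoint X * X"

definition unitary_mat :: "nat \<Rightarrow> complex mat \<Rightarrow> bool" where
  "unitary_mat k U \<longleftrightarrow> U \<in> carrier_mat k k \<and>
     mat_adjoint U * U = 1\<^sub>m k \<and> U * mat_adjoint U = 1\<^sub>m k"

text \<open>The diagonal of \<open>H\<close> is taken real: the notion is used for Hermitian \<open>H\<close> only, where a
  unitary diagonalization always has a real diagonal.\<close>

definition unitarily_diagonalizes ::
    "nat \<Rightarrow> complex mat \<Rightarrow> complex mat \<Rightarrow> complex mat \<Rightarrow> (nat \<Rightarrow> real) \<Rightarrow> (nat \<Rightarrow> complex) \<Rightarrow> bool" where
  "unitarily_diagonalizes k U H Z h z \<longleftrightarrow> unitary_mat k U \<and>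
     mat_adjoint U * H * U = mat_diag k (\<lambda>j. complex_of_real (h j)) \<and>
     mat_adjoint U * Z * U = mat_diag k z"

text \<open>\<open>ellipse_axes E c d a b\<close>: \<open>E\<close> is the closed region bounded by the ellipse with center \<open>c\<close>,
  major axis of length \<open>2 * a\<close> parallel to \<open>d\<close> and minor axis of length \<open>2 * b\<close>. Degenerate
  ellipses (\<open>b = 0\<close>: a segment, \<open>a = b = 0\<close>: a point) are admitted.\<close>

definition ellipse_axes :: "complex set \<Rightarrow> complex \<Rightarrow> complex \<Rightarrow> real \<Rightarrow> real \<Rightarrow> bool" where
  "ellipse_axes E c d a b \<longleftrightarrow> cmod d = 1 \<and> 0 \<le> b \<and> b \<le> a \<and>
     E = {c + d * Complex (a * x) (b * y) | x y. x\<^sup>2 + y\<^sup>2 \<le> 1}"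

definition is_ellipse :: "complex set \<Rightarrow> bool" where
  "is_ellipse E \<longleftrightarrow> (\<exists>c d a b. ellipse_axes E c d a b)"

text \<open>The line \<open>{w. Im (cis (- \<theta>) * w) = s}\<close>, which has direction \<open>cis \<theta>\<close>, touches \<open>E\<close> and has
  \<open>E\<close> on one side; this is tangency for an ellipse and also makes sense for a degenerate one.\<close>

definition tangent_line :: "complex set \<Rightarrow> real \<Rightarrow> real \<Rightarrow> bool" where
  "tangent_line E \<theta> s \<longleftrightarrow> (\<exists>w\<in>E. Im (cis (- \<theta>) * w) = s) \<and>
     ((\<forall>w\<in>E. Im (cis (- \<theta>) * w) \<le> s) \<or> (\<forall>w\<in>E. Im (cis (- \<theta>) * w) \<ge> s))"

definition lambda_of :: "complex \<Rightarrow> (real \<Rightarrow> real) \<Rightarrow> real \<Rightarrow> real" where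
  "lambda_of \<gamma> \<mu> \<theta> = sqrt ((Im (cis (- \<theta>) * \<gamma>))\<^sup>2 + \<mu> \<theta> / 4)"

text \<open>\<open>E\<close> is the ellipse associated with \<open>\<mu>\<close>: after translating \<open>c\<close> to the origin, its tangent
  lines of direction \<open>cis \<theta>\<close> are those at height \<open>\<plusminus> lambda_of \<gamma> \<mu> \<theta>\<close>.\<close>

definition associated_ellipse ::
    "complex \<Rightarrow> complex \<Rightarrow> (real \<Rightarrow> real) \<Rightarrow> complex set \<Rightarrow> bool" where
  "associated_ellipse c \<gamma> \<mu> E \<longleftrightarrow> is_ellipse E \<and>
     (\<forall>\<theta> s. tangent_line ((\<lambda>w. w - c) ` E) \<theta> s \<longleftrightarrow>
        s = lambda_of \<gamma> \<mu> \<theta> \<or> s = - lambda_of \<gamma> \<mu> \<theta>)"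

text \<open>The width \<open>2 * lambda_of \<gamma> \<mu> \<theta>\<close>, for \<open>\<mu> \<theta> = h - 2 * Re (cis (- 2 * \<theta>) * z)\<close>, is largest at
  \<open>\<theta> = axis_angle \<gamma> z\<close>. The tangent lines at the two ends of the major axis therefore have direction
  \<open>cis (axis_angle \<gamma> z)\<close>, and the major axis, perpendicular to them, has direction
  \<open>\<i> * cis (axis_angle \<gamma> z)\<close>. (If \<open>\<gamma>\<^sup>2 + z = 0\<close> the ellipse is a disc and any direction serves.)\<close>

definition axis_angle :: "complex \<Rightarrow> complex \<Rightarrow> real" where
  "axis_angle \<gamma> z = Arg (\<i> * csqrt (\<gamma>\<^sup>2 + z))"

end

theory Submission
  imports Defs
begin

text \<open>Put \<open>c = (\<alpha> + \<beta>) / 2\<close>. For a unit vector \<open>(x, y)\<close> the number \<open>Im (cis (- \<theta>) * (w - c))\<close>, where \<open>w\<close> is the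
  value of the quadratic form of \<open>A\<close>, equals \<open>s * (|x|\<^sup>2 - |y|\<^sup>2) + Im \<langle>K y, x\<rangle>\<close> with
  \<open>s = Im (cis (- \<theta>) * \<gamma>)\<close> and \<open>K\<^sup>* K = M(\<theta>) = H - 2 Re (cis (- 2 * \<theta>) Z)\<close>. The eigenvalues \<open>\<mu>\<^sub>j(\<theta>)\<close> of
  \<open>M(\<theta>)\<close> are therefore nonnegative, and the support function of \<open>W(A) - c\<close> is
  \<open>max\<^sub>j sqrt (s\<^sup>2 + \<mu>\<^sub>j(\<theta>) / 4)\<close>. Since
  \<open>s\<^sup>2 + \<mu>\<^sub>j(\<theta>) / 4 = |\<gamma>|\<^sup>2 / 2 + h\<^sub>j / 4 - Re (cis (- 2 * \<theta>) * (\<gamma>\<^sup>2 + z\<^sub>j)) / 2\<close>, the \<open>j\<close>-th square root is the support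
  function of an ellipse with the stated axes. As \<open>W(A)\<close> is compact and convex, it is determined by its support
  function, and so equals the convex hull of the ellipses. No reduction to \<open>2 \<times> 2\<close> blocks is available:
  \<open>C\<^sup>* C\<close> need not be diagonal in the eigenbasis of \<open>H\<close> and \<open>Z\<close>.\<close>

unbundle no vec_syntax and no inner_syntax

section \<open>Adjoints and eigenvectors in invariant subspaces\<close>

lemma dim_mat_adjoint [simp]:
  "dim_row (mat_adjoint A) = dim_col A" "dim_col (mat_adjoint A) = dim_row A"
  unfolding mat_adjoint_def by (auto simp: mat_of_rows_def)

lemma mat_adjoint_carrier [simp, intro]:
  "A \<in> carrier_mat m n \<Longrightarrow> mat_adjoint A \<in> carrier_mat n m"
  by (auto intro!: carrier_matI)

lemma mat_adjoint_index [simp]: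
  fixes A :: "complex mat"
  assumes "i < dim_col A" "j < dim_row A"
  shows "mat_adjoint A $$ (i, j) = cnj (A $$ (j, i))"
  using assms unfolding mat_adjoint_def by (auto simp: mat_of_rows_def)

lemma mat_adjoint_adjoint [simp]:
  fixes A :: "complex mat"
  shows "mat_adjoint (mat_adjoint A) = A"
  by (rule eq_matI) auto

lemma mat_adjoint_mult:
  fixes A B :: "complex mat"
  assumes "A \<in> carrier_mat m n" "B \<in> carrier_mat n p"
  shows "mat_adjoint (A * B) = mat_adjoint B * mat_adjoint A"
  by (rule eq_matI; use assms in \<open>auto simp: scalar_prod_def mult.commute intro!: sum.cong\<close>)

lemma mat_adjoint_add:
  fixes A B :: "complex mat"
  assumes "A \<in> carrier_mat m n" "B \<in> carrier_mat m n"
  shows "mat_adjoint (A + B) = mat_adjoint A + mat_adjoint B"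
  by (rule eq_matI; use assms in auto)

lemma mat_adjoint_smult:
  fixes A :: "complex mat"
  shows "mat_adjoint (c \<cdot>\<^sub>m A) = cnj c \<cdot>\<^sub>m mat_adjoint A"
  by (rule eq_matI) auto

lemma cscalar_prod_sum:
  fixes v w :: "complex Matrix.vec"
  assumes "dim_vec v = n" "dim_vec w = n"
  shows "v \<bullet>c w = (\<Sum>i<n. v $ i * cnj (w $ i))"
  using assms by (auto simp: scalar_prod_def atLeast0LessThan intro!: sum.cong)

lemma mult_mat_vec_index_sum:
  fixes A :: "complex mat"
  assumes "A \<in> carrier_mat m n" "x \<in> carrier_vec n" "i < m"
  shows "(A *\<^sub>v x) $ i = (\<Sum>j<n. A $$ (i, j) * x $ j)"
  using assms by (auto simp: scalar_prod_def atLeast0LessThan intro!: sum.cong)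

lemma cscalar_prod_adjoint:
  fixes A :: "complex mat"
  assumes A: "A \<in> carrier_mat m n" and x: "x \<in> carrier_vec n" and y: "y \<in> carrier_vec m"
  shows "(A *\<^sub>v x) \<bullet>c y = x \<bullet>c (mat_adjoint A *\<^sub>v y)"
proof -
  have "(A *\<^sub>v x) \<bullet>c y = (\<Sum>i<m. \<Sum>j<n. A $$ (i, j) * x $ j * cnj (y $ i))"
    using assms
    by (subst cscalar_prod_sum[of _ m])
      (auto simp: mult_mat_vec_index_sum[OF A x] sum_distrib_right simp del: index_mult_mat_vec)
  also have "\<dots> = (\<Sum>j<n. \<Sum>i<m. A $$ (i, j) * x $ j * cnj (y $ i))"
    by (rule sum.swap)
  also have "\<dots> = x \<bullet>c (mat_adjoint A *\<^sub>v y)"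
    using assms
    by (subst cscalar_prod_sum[of _ n])
      (auto simp: mult_mat_vec_index_sum[OF mat_adjoint_carrier[OF A] y] 
        sum_distrib_left mult_ac simp del: index_mult_mat_vec)
  finally show ?thesis .
qed

lemma cscalar_prod_commute:
  fixes v w :: "complex Matrix.vec"
  assumes "v \<in> carrier_vec n" "w \<in> carrier_vec n"
  shows "v \<bullet>c w = cnj (w \<bullet>c v)"
  using assms by (simp add: cscalar_prod_sum mult.commute)

text \<open>Write \<open>Z = P * B * Q\<close> with \<open>B\<close> upper triangular and choose \<open>x \<noteq> 0\<close> in \<open>S\<close> such that the last nonzero
  coordinate of \<open>Q x\<close> has the least possible index \<open>d\<close>. Subtracting the diagonal entry \<open>B $$ (d, d)\<close>
  kills that coordinate, so minimality forces \<open>Z x - B $$ (d, d) x = 0\<close>.\<close>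

lemma invariant_subspace_eigenvector:
  fixes Z :: "complex mat"
  assumes Z: "Z \<in> carrier_mat k k" and S: "S \<subseteq> carrier_vec k"
    and inv: "\<And>e v. v \<in> S \<Longrightarrow> Z *\<^sub>v v - e \<cdot>\<^sub>v v \<in> S"
    and v: "v \<in> S" "v \<noteq> 0\<^sub>v k"
  shows "\<exists>w\<in>S. w \<noteq> 0\<^sub>v k \<and> (\<exists>e. Z *\<^sub>v w = e \<cdot>\<^sub>v w)"
proof -
  from char_poly_factorized[OF Z] obtain es where "char_poly Z = (\<Prod>a\<leftarrow>es. [:- a, 1:])" by auto
  from schur_decomposition_exists[OF Z this] obtain B where
    B: "B \<in> carrier_mat k k" "upper_triangular B" and sim: "similar_mat Z B" by auto
  from sim obtain P Q where wit: "similar_mat_wit Z B P Q" unfolding similar_mat_def by auto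
  have PQ: "P \<in> carrier_mat k k" "Q \<in> carrier_mat k k" "P * Q = 1\<^sub>m k" "Q * P = 1\<^sub>m k"
    and ZB: "Z = P * B * Q"
    by (fact similar_mat_witD2[OF Z wit])+
  have "Q * Z = (Q * P) * (B * Q)"
    unfolding ZB using PQ(1,2) B(1) by (simp add: assoc_mult_mat[of _ k k _ k _ k])
  then have QZ: "Q * Z = B * Q" using PQ B by simp
  have Q0: "Q *\<^sub>v x \<noteq> 0\<^sub>v k" if "x \<in> carrier_vec k" "x \<noteq> 0\<^sub>v k" for x
  proof
    assume "Q *\<^sub>v x = 0\<^sub>v k"
    then have "P *\<^sub>v (Q *\<^sub>v x) = 0\<^sub>v k" using PQ(1) by (intro eq_vecI) auto
    moreover have "P *\<^sub>v (Q *\<^sub>v x) = x"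
      using assoc_mult_mat_vec[OF PQ(1,2) that(1)] PQ(3) that by simp
    ultimately show False using that by simp
  qed
  \<comment> \<open>\<open>R m x\<close> says that \<open>m\<close> is an exclusive bound for the
    support of \<open>Q *\<^sub>v x\<close>; the least such \<open>m\<close> over all nonzero
    \<open>x\<close> in \<open>S\<close> is taken.\<close>
  define R where "R m x \<longleftrightarrow> x \<in> S \<and> x \<noteq> 0\<^sub>v k \<and> (\<forall>i<k. m \<le> i \<longrightarrow> (Q *\<^sub>v x) $ i = 0)" for m x
  define m where "m = (LEAST m. \<exists>x. R m x)"
  have "\<exists>m x. R m x" using v unfolding R_def by (intro exI[of _ k] exI[of _ v]) auto
  then have "\<exists>x. R m x" unfolding m_def by (rule LeastI_ex)
  then obtain x where x: "R m x" by auto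
  have min: "\<not> R l y" if "l < m" for l y
    using not_less_Least[OF that[unfolded m_def]] by auto
  have xS: "x \<in> S" "x \<noteq> 0\<^sub>v k" and xc: "x \<in> carrier_vec k" using x S unfolding R_def by auto
  have m0: "m \<noteq> 0"
  proof
    assume "m = 0"
    with x have "Q *\<^sub>v x = 0\<^sub>v k" unfolding R_def using PQ by (intro eq_vecI) auto
    with Q0 xS xc show False by auto
  qed
  have mk: "m \<le> k"
  proof (rule ccontr)
    assume "\<not> m \<le> k"
    then have "R k x" using x unfolding R_def by auto
    with min[of k x] \<open>\<not> m \<le> k\<close> show False by auto
  qed
  \<comment> \<open>Since \<open>m\<close> is an exclusive bound, the last nonzero coordinate sits
    at \<open>m - 1\<close>; by \<open>m0\<close> the subtraction does not truncate.\<close>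
  define d where "d = m - 1"
  have dk: "d < k" and dm: "m = Suc d" using m0 mk d_def by auto
  define e where "e = B $$ (d, d)"
  define w where "w = Z *\<^sub>v x - e \<cdot>\<^sub>v x"
  have wS: "w \<in> S" unfolding w_def by (rule inv[OF xS(1)])
  have Qw: "Q *\<^sub>v w = B *\<^sub>v (Q *\<^sub>v x) - e \<cdot>\<^sub>v (Q *\<^sub>v x)"
  proof -
    have "Q *\<^sub>v w = Q *\<^sub>v (Z *\<^sub>v x) - e \<cdot>\<^sub>v (Q *\<^sub>v x)"
      unfolding w_def using PQ Z xc by (subst mult_minus_distrib_mat_vec[of _ k k]) (auto simp: mult_mat_vec[of _ k k])
    also have "Q *\<^sub>v (Z *\<^sub>v x) = B *\<^sub>v (Q *\<^sub>v x)"
      using assoc_mult_mat_vec[OF PQ(2) Z xc] assoc_mult_mat_vec[OF B(1) PQ(2) xc] QZ by simp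
    finally show ?thesis .
  qed
  have "(Q *\<^sub>v w) $ i = 0" if i: "i < k" "d \<le> i" for i
  proof -
    have y: "Q *\<^sub>v x \<in> carrier_vec k" using PQ xc by auto
    have y0: "(Q *\<^sub>v x) $ j = 0" if "j < k" "d < j" for j using x that dm unfolding R_def by auto
    have "(B *\<^sub>v (Q *\<^sub>v x)) $ i = (\<Sum>j<k. B $$ (i, j) * (Q *\<^sub>v x) $ j)"
      by (rule mult_mat_vec_index_sum[OF B(1) y i(1)])
    \<comment> \<open>Terms with \<open>j < i\<close> vanish because \<open>B\<close> is upper
      triangular, those with \<open>j > i\<close> because \<open>i\<close> is at least
      \<open>d\<close>, the last index in the support.\<close>
    also have "\<dots> = (\<Sum>j\<in>{i}. B $$ (i, j) * (Q *\<^sub>v x) $ j)"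
    proof (rule sum.mono_neutral_right)
      show "\<forall>j\<in>{..<k} - {i}. B $$ (i, j) * (Q *\<^sub>v x) $ j = 0"
      proof
        fix j assume j: "j \<in> {..<k} - {i}"
        show "B $$ (i, j) * (Q *\<^sub>v x) $ j = 0"
        proof (cases "j < i")
          case True then show ?thesis using B i j unfolding upper_triangular_def by auto
        next
          case False then show ?thesis using y0[of j] i j by auto
        qed
      qed
    qed (use i in auto)
    finally have "(B *\<^sub>v (Q *\<^sub>v x)) $ i = B $$ (i, i) * (Q *\<^sub>v x) $ i" by simp
    then show ?thesis unfolding Qw using i PQ B y0[of i] by (cases "i = d") (auto simp: e_def)
  qed
  then have "w = 0\<^sub>v k" using min[of d w] dm wS unfolding R_def by auto
  then have w0: "w $ i = 0" if "i < k" for i using that by simp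
  have "Z *\<^sub>v x = e \<cdot>\<^sub>v x"
    by (rule eq_vecI; use w0 Z xc in \<open>auto simp: w_def\<close>)
  then show ?thesis using xS by auto
qed

section \<open>Simultaneous unitary diagonalization\<close>

text \<open>Induction over the list: the eigenvectors of \<open>T\<close> in \<open>S\<close> for
  one eigenvalue \<open>e\<close> stay closed under the other matrices, because these commute with
  \<open>T\<close>. Closure under \<open>X *\<^sub>v v - e \<cdot>\<^sub>v v\<close> replaces the
  notion of an invariant subspace; it is what the single-matrix case asks for, and it passes to
  \<open>S'\<close>.\<close>

lemma common_eigenvector:
  fixes Ts :: "complex mat list"
  assumes "set Ts \<subseteq> carrier_mat k k"
    and "\<And>X Y. X \<in> set Ts \<Longrightarrow> Y \<in> set Ts \<Longrightarrow> X * Y = Y * X"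
    and "S \<subseteq> carrier_vec k"
    and "\<And>X e v. X \<in> set Ts \<Longrightarrow> v \<in> S \<Longrightarrow> X *\<^sub>v v - e \<cdot>\<^sub>v v \<in> S"
    and "v \<in> S" "v \<noteq> 0\<^sub>v k"
  shows "\<exists>w\<in>S. w \<noteq> 0\<^sub>v k \<and> (\<forall>X\<in>set Ts. \<exists>e. X *\<^sub>v w = e \<cdot>\<^sub>v w)"
  using assms
proof (induction Ts arbitrary: S v)
  case Nil
  then show ?case by auto
next
  case (Cons T Ts)
  have T: "T \<in> carrier_mat k k" using Cons.prems by auto
  obtain w e where w: "w \<in> S" "w \<noteq> 0\<^sub>v k" "T *\<^sub>v w = e \<cdot>\<^sub>v w"
    using invariant_subspace_eigenvector[OF T Cons.prems(3) _ Cons.prems(5,6)] Cons.prems(4) by auto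
  define S' where "S' = {x \<in> S. T *\<^sub>v x = e \<cdot>\<^sub>v x}"
  have "X *\<^sub>v x - d \<cdot>\<^sub>v x \<in> S'" if X: "X \<in> set Ts" and x: "x \<in> S'" for X d x
  proof -
    have Xc: "X \<in> carrier_mat k k" and xc: "x \<in> carrier_vec k" and xe: "T *\<^sub>v x = e \<cdot>\<^sub>v x"
      and xS: "x \<in> S"
      using X x Cons.prems(1,3) by (auto simp: S'_def)
    have "T *\<^sub>v (X *\<^sub>v x) = X *\<^sub>v (T *\<^sub>v x)"
      using Cons.prems(2)[of T X] X assoc_mult_mat_vec[OF T Xc xc] assoc_mult_mat_vec[OF Xc T xc] by simp
    then have TX: "T *\<^sub>v (X *\<^sub>v x) = e \<cdot>\<^sub>v (X *\<^sub>v x)"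
      using xe mult_mat_vec[OF Xc xc] by simp
    have "T *\<^sub>v (X *\<^sub>v x - d \<cdot>\<^sub>v x) = T *\<^sub>v (X *\<^sub>v x) - d \<cdot>\<^sub>v (T *\<^sub>v x)"
      using T Xc xc mult_mat_vec[OF T xc] by (subst mult_minus_distrib_mat_vec[of _ k k]) auto
    also have "\<dots> = e \<cdot>\<^sub>v (X *\<^sub>v x - d \<cdot>\<^sub>v x)"
      unfolding TX xe using Xc xc by (intro eq_vecI) (auto simp: algebra_simps)
    finally show ?thesis using Cons.prems(4)[of X x d] X xS by (auto simp: S'_def)
  qed
  moreover have "S' \<subseteq> carrier_vec k" "w \<in> S'" using Cons.prems(3) w by (auto simp: S'_def)
  ultimately obtain u where "u \<in> S'" "u \<noteq> 0\<^sub>v k" "\<forall>X\<in>set Ts. \<exists>e. X *\<^sub>v u = e \<cdot>\<^sub>v u"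
    using Cons.IH[of S' w] Cons.prems(1,2) w(2) by auto
  then show ?case by (auto simp: S'_def)
qed

text \<open>The conjugated vectors, padded with zero rows, form a singular square matrix; a nonzero
  vector in its kernel is orthogonal to all of them.\<close>

lemma exists_orthogonal_vec:
  fixes vs :: "complex Matrix.vec list"
  assumes vs: "set vs \<subseteq> carrier_vec k" and len: "length vs < k"
  shows "\<exists>x\<in>carrier_vec k. x \<noteq> 0\<^sub>v k \<and> (\<forall>v\<in>set vs. x \<bullet>c v = 0)"
proof -
  define M where "M = Matrix.mat k k (\<lambda>(i, j). if i < length vs then cnj (vs ! i $ j) else 0)"
  have M: "M \<in> carrier_mat k k" unfolding M_def by auto
  have row: "Matrix.row M i = conjugate (vs ! i)" if "i < length vs" for i
  proof (rule eq_vecI)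
    have "dim_vec (vs ! i) = k" using vs that by (auto simp: subset_iff)
    then show "dim_vec (Matrix.row M i) = dim_vec (conjugate (vs ! i))" using M by simp
    fix j assume "j < dim_vec (conjugate (vs ! i))"
    then show "Matrix.row M i $ j = conjugate (vs ! i) $ j"
      using that len \<open>dim_vec (vs ! i) = k\<close> by (auto simp: M_def)
  qed
  have zero: "Matrix.row M (length vs) = 0\<^sub>v k"
    by (rule eq_vecI) (use len in \<open>auto simp: M_def\<close>)
  have "Determinant.det M = 0"
  proof -
    \<comment> \<open>Row \<open>length vs\<close> is the first padding row; displaying it as zero
      gives the shape that \<open>det_row_0\<close> expects.\<close>
    have "Determinant.det M = Determinant.det (mat\<^sub>r k k (\<lambda>i. if i = length vs then 0\<^sub>v k else Matrix.row M i))"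
      by (rule arg_cong[of _ _ Determinant.det], rule eq_matI) (use len in \<open>auto simp: M_def\<close>)
    also have "\<dots> = 0" by (rule det_row_0[OF len]) (use M in auto)
    finally show ?thesis .
  qed
  then obtain x where x: "x \<in> carrier_vec k" "x \<noteq> 0\<^sub>v k" "M *\<^sub>v x = 0\<^sub>v k"
    using det_0_iff_vec_prod_zero[OF M] by auto
  have "x \<bullet>c v = 0" if v: "v \<in> set vs" for v
  proof -
    from v obtain i where i: "i < length vs" "v = vs ! i" by (auto simp: in_set_conv_nth)
    have vc: "v \<in> carrier_vec k" using v vs by auto
    have "(M *\<^sub>v x) $ i = Matrix.row M i \<bullet> x" using M i len by simp
    then have "conjugate v \<bullet> x = 0" using x row[OF i(1)] i len by simp
    then show ?thesis using comm_scalar_prod[of "conjugate v" k x] vc x by simp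
  qed
  then show ?thesis using x by blast
qed

text \<open>The system is extended one vector at a time inside the orthogonal complement
  \<open>S\<close> of the vectors found so far. Closure of \<open>Ts\<close> under adjoints makes
  \<open>S\<close> invariant: \<open>X *\<^sub>v x\<close> paired with \<open>v\<close> equals
  \<open>x\<close> paired with \<open>mat_adjoint X *\<^sub>v v\<close>, a multiple of
  \<open>v\<close>.\<close>

lemma orthonormal_common_eigenvectors:
  fixes Ts :: "complex mat list"
  assumes Ts: "set Ts \<subseteq> carrier_mat k k"
    and comm: "\<And>X Y. X \<in> set Ts \<Longrightarrow> Y \<in> set Ts \<Longrightarrow> X * Y = Y * X"
    and adj: "\<And>X. X \<in> set Ts \<Longrightarrow> mat_adjoint X \<in> set Ts"
    and "m \<le> k"
  shows "\<exists>vs. length vs = m \<and> set vs \<subseteq> carrier_vec k \<and>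
    (\<forall>i<m. \<forall>j<m. vs ! i \<bullet>c vs ! j = (if i = j then 1 else 0)) \<and>
    (\<forall>v\<in>set vs. \<forall>X\<in>set Ts. \<exists>e. X *\<^sub>v v = e \<cdot>\<^sub>v v)"
  using \<open>m \<le> k\<close>
proof (induction m)
  case 0
  then show ?case by auto
next
  case (Suc m)
  then obtain vs where vs: "length vs = m" "set vs \<subseteq> carrier_vec k"
    "\<forall>i<m. \<forall>j<m. vs ! i \<bullet>c vs ! j = (if i = j then 1 else 0)"
    "\<forall>v\<in>set vs. \<forall>X\<in>set Ts. \<exists>e. X *\<^sub>v v = e \<cdot>\<^sub>v v" by auto
  define S where "S = {x \<in> carrier_vec k. \<forall>v\<in>set vs. x \<bullet>c v = 0}"
  obtain x where "x \<in> S" "x \<noteq> 0\<^sub>v k"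
    using exists_orthogonal_vec[OF vs(2)] vs(1) Suc.prems by (auto simp: S_def)
  moreover have "X *\<^sub>v x - e \<cdot>\<^sub>v x \<in> S" if X: "X \<in> set Ts" and x: "x \<in> S" for X e x
  proof -
    have Xc: "X \<in> carrier_mat k k" and xc: "x \<in> carrier_vec k" using X x Ts by (auto simp: S_def)
    have "(X *\<^sub>v x - e \<cdot>\<^sub>v x) \<bullet>c v = 0" if v: "v \<in> set vs" for v
    proof -
      have vc: "v \<in> carrier_vec k" using v vs by auto
      obtain d where d: "mat_adjoint X *\<^sub>v v = d \<cdot>\<^sub>v v" using vs(4) v adj[OF X] by blast
      have "(X *\<^sub>v x - e \<cdot>\<^sub>v x) \<bullet>c v = (X *\<^sub>v x) \<bullet>c v - e * (x \<bullet>c v)"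
        using Xc xc vc by (subst minus_scalar_prod_distrib[of _ k]) auto
      also have "(X *\<^sub>v x) \<bullet>c v = cnj d * (x \<bullet>c v)"
        unfolding cscalar_prod_adjoint[OF Xc xc vc] d using xc vc
        by (simp add: conjugate_smult_vec)
      finally show ?thesis using x v by (simp add: S_def)
    qed
    then show ?thesis using Xc xc by (auto simp: S_def)
  qed
  ultimately obtain w where w: "w \<in> S" "w \<noteq> 0\<^sub>v k" "\<forall>X\<in>set Ts. \<exists>e. X *\<^sub>v w = e \<cdot>\<^sub>v w"
    using common_eigenvector[OF Ts comm, of S x] by (auto simp: S_def)
  have wc: "w \<in> carrier_vec k" using w by (auto simp: S_def)
  define r where "r = sqrt (Re (w \<bullet>c w))"
  have ww: "w \<bullet>c w > 0" using w wc by simp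
  have r: "r > 0" "w \<bullet>c w = complex_of_real (r\<^sup>2)"
    using ww by (auto simp: r_def less_complex_def complex_eq_iff)
  define u where "u = complex_of_real (1 / r) \<cdot>\<^sub>v w"
  have uc: "u \<in> carrier_vec k" using wc by (simp add: u_def)
  have uu: "u \<bullet>c u = 1"
    using wc r by (simp add: u_def conjugate_smult_vec power2_eq_square)
  have uv: "u \<bullet>c v = 0" if "v \<in> set vs" for v
  proof -
    have "v \<in> carrier_vec k" using that vs by auto
    then show ?thesis using w wc that by (simp add: u_def S_def)
  qed
  have vu: "v \<bullet>c u = 0" if "v \<in> set vs" for v
    using uv[OF that] cscalar_prod_commute[of v k u] uc that vs by auto
  have ue: "\<exists>e. X *\<^sub>v u = e \<cdot>\<^sub>v u" if "X \<in> set Ts" for X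
  proof -
    from that w obtain e where "X *\<^sub>v w = e \<cdot>\<^sub>v w" by blast
    moreover have "X \<in> carrier_mat k k" using that Ts by auto
    ultimately have "X *\<^sub>v u = e \<cdot>\<^sub>v u"
      using wc by (simp add: u_def mult_mat_vec[of _ k k] smult_smult_assoc mult.commute)
    then show ?thesis by blast
  qed
  show ?case
  proof (intro exI[of _ "vs @ [u]"] conjI allI impI)
    fix i j assume "i < Suc m" "j < Suc m"
    then show "(vs @ [u]) ! i \<bullet>c (vs @ [u]) ! j = (if i = j then 1 else 0)"
      using vs uu uv[OF nth_mem, of i] vu[OF nth_mem, of i] uv[OF nth_mem, of j] vu[OF nth_mem, of j]
      by (auto simp: nth_append less_Suc_eq)
  qed (use vs uc ue in auto)
qed

text \<open>Translates between a matrix congruence and the sesquilinear form evaluated on columns;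
  with \<open>X\<close> the identity it expresses orthonormality of the columns.\<close>

lemma adjoint_conj_index:
  fixes X V :: "complex mat"
  assumes V: "V \<in> carrier_mat k m" and X: "X \<in> carrier_mat k k" and ij: "i < m" "j < m"
  shows "(mat_adjoint V * X * V) $$ (i, j) = (X *\<^sub>v Matrix.col V j) \<bullet>c Matrix.col V i"
proof -
  have "(mat_adjoint V * X * V) $$ (i, j) = (mat_adjoint V * (X * V)) $$ (i, j)"
    using assoc_mult_mat[OF mat_adjoint_carrier[OF V] X V] by simp
  also have "\<dots> = (\<Sum>l<k. cnj (V $$ (l, i)) * (X *\<^sub>v Matrix.col V j) $ l)"
    using assms by (auto simp: scalar_prod_def atLeast0LessThan intro!: sum.cong)
  also have "\<dots> = (X *\<^sub>v Matrix.col V j) \<bullet>c Matrix.col V i"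
    using assms by (subst cscalar_prod_sum[of _ k]) (auto simp: mult.commute intro!: sum.cong)
  finally show ?thesis .
qed

text \<open>The list \<open>[H, Z, mat_adjoint Z]\<close> is closed under adjoints and commutes
  pairwise: normality handles \<open>Z\<close> with its adjoint, and taking adjoints in
  \<open>Z * H = H * Z\<close> handles \<open>H\<close> with \<open>mat_adjoint Z\<close>. An
  orthonormal basis of common eigenvectors supplies the columns of \<open>U\<close>.\<close>

lemma simultaneous_unitary_diagonalization:
  assumes H: "H \<in> carrier_mat k k" and Z: "Z \<in> carrier_mat k k"
    and herm: "mat_adjoint H = H" and normal: "normal_mat Z" and comm: "Z * H = H * Z"
  shows "\<exists>U h z. unitarily_diagonalizes k U H Z h z"
proof -
  define Ts where "Ts = [H, Z, mat_adjoint Z]"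
  have comm': "mat_adjoint Z * H = H * mat_adjoint Z"
    using arg_cong[OF comm, of mat_adjoint] mat_adjoint_mult[OF Z H] mat_adjoint_mult[OF H Z] herm by simp
  have "\<exists>vs. length vs = k \<and> set vs \<subseteq> carrier_vec k \<and>
    (\<forall>i<k. \<forall>j<k. vs ! i \<bullet>c vs ! j = (if i = j then 1 else 0)) \<and>
    (\<forall>v\<in>set vs. \<forall>X\<in>set Ts. \<exists>e. X *\<^sub>v v = e \<cdot>\<^sub>v v)"
    by (rule orthonormal_common_eigenvectors)
      (use H Z herm comm comm' normal in \<open>auto simp: Ts_def normal_mat_def\<close>)
  then obtain vs where vs: "length vs = k" "set vs \<subseteq> carrier_vec k"
    "\<And>i j. i < k \<Longrightarrow> j < k \<Longrightarrow> vs ! i \<bullet>c vs ! j = (if i = j then 1 else 0)"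
    "\<And>v X. v \<in> set vs \<Longrightarrow> X \<in> set Ts \<Longrightarrow> \<exists>e. X *\<^sub>v v = e \<cdot>\<^sub>v v" by blast
  define U where "U = mat_of_cols k vs"
  have U: "U \<in> carrier_mat k k" using vs by (auto simp: U_def)
  have col: "Matrix.col U j = vs ! j" if "j < k" for j
    using that vs by (auto simp: U_def intro!: col_mat_of_cols)
  have vc: "vs ! j \<in> carrier_vec k" if "j < k" for j using that vs by auto
  have diag: "\<exists>f. mat_adjoint U * X * U = mat_diag k f \<and> (\<forall>j<k. X *\<^sub>v vs ! j = f j \<cdot>\<^sub>v vs ! j)"
    if X: "X \<in> carrier_mat k k" and ev: "\<And>v. v \<in> set vs \<Longrightarrow> \<exists>e. X *\<^sub>v v = e \<cdot>\<^sub>v v" for X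
  proof -
    have "\<forall>j. \<exists>e. j < k \<longrightarrow> X *\<^sub>v vs ! j = e \<cdot>\<^sub>v vs ! j" using ev vs(1) by auto
    then obtain f where f: "\<And>j. j < k \<Longrightarrow> X *\<^sub>v vs ! j = f j \<cdot>\<^sub>v vs ! j" by metis
    have "mat_adjoint U * X * U = mat_diag k f"
    proof (rule eq_matI)
      fix i j assume "i < dim_row (mat_diag k f)" "j < dim_col (mat_diag k f)"
      then have ij: "i < k" "j < k" by (auto simp: mat_diag_def)
      have "(f j \<cdot>\<^sub>v vs ! j) \<bullet>c vs ! i = f j * (vs ! j \<bullet>c vs ! i)" using vc[OF ij(1)] vc[OF ij(2)] by simp
      then show "(mat_adjoint U * X * U) $$ (i, j) = mat_diag k f $$ (i, j)"
        unfolding adjoint_conj_index[OF U X ij] using ij f vs(3)[OF ij(2,1)] by (auto simp: col mat_diag_def)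
    qed (use U in \<open>auto simp: mat_diag_def\<close>)
    then show ?thesis using f by auto
  qed
  obtain hc where hc: "mat_adjoint U * H * U = mat_diag k hc" "\<And>j. j < k \<Longrightarrow> H *\<^sub>v vs ! j = hc j \<cdot>\<^sub>v vs ! j"
    using diag[OF H] vs(4)[of _ H] by (auto simp: Ts_def)
  obtain z where z: "mat_adjoint U * Z * U = mat_diag k z"
    using diag[OF Z] vs(4)[of _ Z] by (auto simp: Ts_def)
  have UU: "mat_adjoint U * U = 1\<^sub>m k"
  proof (rule eq_matI)
    fix i j assume "i < dim_row (1\<^sub>m k)" "j < dim_col (1\<^sub>m k)"
    then have ij: "i < k" "j < k" by auto
    \<comment> \<open>An identity factor is inserted so that \<open>adjoint_conj_index\<close>
      applies.\<close>
    have "(mat_adjoint U * U) $$ (i, j) = (mat_adjoint U * 1\<^sub>m k * U) $$ (i, j)"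
      using U by (simp add: right_mult_one_mat[of _ k k])
    then show "(mat_adjoint U * U) $$ (i, j) = 1\<^sub>m k $$ (i, j)"
      unfolding adjoint_conj_index[OF U one_carrier_mat ij] using ij vs(3)[OF ij(2,1)] vc[OF ij(2)] by (simp add: col)
  qed (use U in auto)
  have "U * mat_adjoint U = 1\<^sub>m k"
    using mat_mult_left_right_inverse[OF mat_adjoint_carrier[OF U] U UU] .
  with UU U have un: "unitary_mat k U" by (simp add: unitary_mat_def)
  have hreal: "hc j = complex_of_real (Re (hc j))" if j: "j < k" for j
  proof -
    have "(H *\<^sub>v vs ! j) \<bullet>c vs ! j = vs ! j \<bullet>c (H *\<^sub>v vs ! j)"
      using cscalar_prod_adjoint[OF H vc[OF j] vc[OF j]] herm by simp
    then have "hc j = cnj (hc j)"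
      unfolding hc(2)[OF j] using vc[OF j] vs(3)[OF j j] by (simp add: conjugate_smult_vec)
    then show ?thesis by (simp add: complex_eq_iff)
  qed
  have "mat_diag k hc = mat_diag k (\<lambda>j. complex_of_real (Re (hc j)))"
    by (rule eq_matI) (use hreal in \<open>auto simp: mat_diag_def\<close>)
  then show ?thesis using un hc(1) z unfolding unitarily_diagonalizes_def by metis
qed

section \<open>Forms, eigenvalues and the pencil in a diagonalizing basis\<close>

lemma unitary_diagonal_quadratic_form:
  assumes U: "unitary_mat k U" and X: "X \<in> carrier_mat k k"
    and D: "mat_adjoint U * X * U = mat_diag k d" and x: "x \<in> carrier_vec k"
  shows "(X *\<^sub>v x) \<bullet>c x = (\<Sum>j<k. d j * complex_of_real ((cmod ((mat_adjoint U *\<^sub>v x) $ j))\<^sup>2))"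
proof -
  have Uc: "U \<in> carrier_mat k k" "U * mat_adjoint U = 1\<^sub>m k" using U by (auto simp: unitary_mat_def)
  note Ac = mat_adjoint_carrier[OF Uc(1)]
  define y where "y = mat_adjoint U *\<^sub>v x"
  have yc: "y \<in> carrier_vec k" using Ac x by (auto simp: y_def)
  have "U *\<^sub>v y = x" using assoc_mult_mat_vec[OF Uc(1) Ac x] Uc(2) x by (simp add: y_def)
  then have "X *\<^sub>v x = (X * U) *\<^sub>v y" using assoc_mult_mat_vec[OF X Uc(1) yc] by simp
  moreover have "X * U = U * mat_diag k d"
    using assoc_mult_mat[OF Uc(1) Ac, of "X * U" k] assoc_mult_mat[OF Ac X Uc(1)] X Uc D
    by simp
  moreover have "(U * mat_diag k d) *\<^sub>v y = U *\<^sub>v (mat_diag k d *\<^sub>v y)"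
    by (rule assoc_mult_mat_vec[OF Uc(1) mat_diag_dim yc])
  ultimately have "(X *\<^sub>v x) \<bullet>c x = (mat_diag k d *\<^sub>v y) \<bullet>c y"
    using cscalar_prod_adjoint[OF Uc(1) mult_mat_vec_carrier[OF mat_diag_dim yc] x] by (simp add: y_def)
  also have "\<dots> = (\<Sum>j<k. (mat_diag k d *\<^sub>v y) $ j * cnj (y $ j))"
    using yc by (intro cscalar_prod_sum) (auto simp: mat_diag_def)
  also have "\<dots> = (\<Sum>j<k. d j * complex_of_real ((cmod (y $ j))\<^sup>2))"
  proof (rule sum.cong)
    fix j assume "j \<in> {..<k}"
    then have j: "j < k" by simp
    have "(mat_diag k d *\<^sub>v y) $ j = (\<Sum>l<k. mat_diag k d $$ (j, l) * y $ l)"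
      by (rule mult_mat_vec_index_sum[OF mat_diag_dim yc j])
    also have "\<dots> = (\<Sum>l<k. if l = j then d j * y $ j else 0)"
      using j by (intro sum.cong) (auto simp: mat_diag_def)
    also have "\<dots> = d j * y $ j" using j by simp
    finally show "(mat_diag k d *\<^sub>v y) $ j * cnj (y $ j) = d j * complex_of_real ((cmod (y $ j))\<^sup>2)"
      by (simp add: complex_norm_square mult.assoc flip: of_real_power)
  qed simp
  finally show ?thesis by (simp add: y_def)
qed

text \<open>Similarity preserves the characteristic polynomial, so the diagonal entries are the
  eigenvalues with multiplicity.\<close>

lemma char_poly_unitary_diagonal:
  assumes U: "unitary_mat k U" and X: "X \<in> carrier_mat k k"
    and D: "mat_adjoint U * X * U = mat_diag k d"
  shows "char_poly X = (\<Prod>j<k. [:- d j, 1:])"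
proof -
  have Uc: "U \<in> carrier_mat k k" "U * mat_adjoint U = 1\<^sub>m k" "mat_adjoint U * U = 1\<^sub>m k"
    using U by (auto simp: unitary_mat_def)
  note Ac = mat_adjoint_carrier[OF Uc(1)]
  have "similar_mat (mat_diag k d) X"
    by (intro similar_matI[of _ _ "mat_adjoint U" U k]) (use Uc Ac X D in auto)
  then have "char_poly X = char_poly (mat_diag k d)" by (simp add: char_poly_similar)
  also have "\<dots> = (\<Prod>a\<leftarrow>diag_mat (mat_diag k d). [:- a, 1:])"
    by (rule char_poly_upper_triangular[OF mat_diag_dim]) (auto simp: mat_diag_def)
  also have "diag_mat (mat_diag k d) = map d [0..<k]" by (auto simp: diag_mat_def mat_diag_def)
  also have "(\<Prod>a\<leftarrow>map d [0..<k]. [:- a, 1:]) = (\<Prod>j<k. [:- d j, 1:])"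
    by (simp add: comp_def prod.distinct_set_conv_list[symmetric] atLeast0LessThan)
  finally show ?thesis .
qed

text \<open>Taking adjoints in the diagonalization of \<open>Z\<close> diagonalizes
  \<open>mat_adjoint Z\<close> by the same \<open>U\<close>. One basis therefore serves every
  coefficient \<open>c\<close>, hence every angle \<open>\<theta>\<close> when
  \<open>c = cis (- 2 * \<theta>)\<close>.\<close>

lemma unitary_conj_pencil:
  assumes UD: "unitarily_diagonalizes k U H Z h z"
    and H: "H \<in> carrier_mat k k" and Z: "Z \<in> carrier_mat k k"
  shows "mat_adjoint U * (H - 2 \<cdot>\<^sub>m re_mat (c \<cdot>\<^sub>m Z)) * U =
    mat_diag k (\<lambda>j. complex_of_real (h j - 2 * Re (c * z j)))"
proof -
  have Uc: "U \<in> carrier_mat k k" and Hd: "mat_adjoint U * H * U = mat_diag k (\<lambda>j. complex_of_real (h j))"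
    and Zd: "mat_adjoint U * Z * U = mat_diag k z"
    using UD by (auto simp: unitarily_diagonalizes_def unitary_mat_def)
  note Ac = mat_adjoint_carrier[OF Uc] and Zc = mat_adjoint_carrier[OF Z]
  have "mat_adjoint (mat_adjoint U * Z * U) = mat_adjoint U * (mat_adjoint Z * U)"
    by (simp only: mat_adjoint_mult[OF mult_carrier_mat[OF Ac Z] Uc] mat_adjoint_mult[OF Ac Z] mat_adjoint_adjoint)
  also have "\<dots> = mat_adjoint U * mat_adjoint Z * U"
    using assoc_mult_mat[OF Ac Zc Uc] by simp
  finally have "mat_adjoint (mat_diag k z) = mat_adjoint U * mat_adjoint Z * U" by (simp only: Zd)
  moreover have "mat_adjoint (mat_diag k z) = mat_diag k (\<lambda>j. cnj (z j))"
    by (rule eq_matI) (auto simp: mat_diag_def)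
  ultimately have Zd': "mat_adjoint U * mat_adjoint Z * U = mat_diag k (\<lambda>j. cnj (z j))" by simp
  have X: "H - 2 \<cdot>\<^sub>m re_mat (c \<cdot>\<^sub>m Z) \<in> carrier_mat k k"
    using H Z Zc by (auto simp: re_mat_def mat_adjoint_smult)
  show ?thesis
  proof (rule eq_matI)
    fix i j assume "i < dim_row (mat_diag k (\<lambda>j. complex_of_real (h j - 2 * Re (c * z j))))"
      "j < dim_col (mat_diag k (\<lambda>j. complex_of_real (h j - 2 * Re (c * z j))))"
    then have ij: "i < k" "j < k" by (auto simp: mat_diag_def)
    define u v where "u = Matrix.col U j" and "v = Matrix.col U i"
    have uv: "u \<in> carrier_vec k" "v \<in> carrier_vec k" using Uc by (auto simp: u_def v_def)
    note ix = adjoint_conj_index[OF Uc _ ij, folded u_def v_def]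
    have Hu: "(H *\<^sub>v u) \<bullet>c v = (if i = j then complex_of_real (h j) else 0)"
      using ix[OF H] ij unfolding Hd by (simp add: mat_diag_def)
    have Zu: "(Z *\<^sub>v u) \<bullet>c v = (if i = j then z j else 0)"
      using ix[OF Z] ij unfolding Zd by (simp add: mat_diag_def)
    have Zu': "(mat_adjoint Z *\<^sub>v u) \<bullet>c v = (if i = j then cnj (z j) else 0)"
      using ix[OF Zc] ij unfolding Zd' by (simp add: mat_diag_def)
    have "(H - 2 \<cdot>\<^sub>m re_mat (c \<cdot>\<^sub>m Z)) *\<^sub>v u =
      H *\<^sub>v u - (c \<cdot>\<^sub>v (Z *\<^sub>v u) + cnj c \<cdot>\<^sub>v (mat_adjoint Z *\<^sub>v u))"
    proof (rule eq_vecI)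
      fix l assume "l < dim_vec (H *\<^sub>v u - (c \<cdot>\<^sub>v (Z *\<^sub>v u) + cnj c \<cdot>\<^sub>v (mat_adjoint Z *\<^sub>v u)))"
      then have l: "l < k" using Z by simp
      have "((H - 2 \<cdot>\<^sub>m re_mat (c \<cdot>\<^sub>m Z)) *\<^sub>v u) $ l =
        (\<Sum>m<k. H $$ (l, m) * u $ m - (c * (Z $$ (l, m) * u $ m) + cnj c * (mat_adjoint Z $$ (l, m) * u $ m)))"
        unfolding mult_mat_vec_index_sum[OF X uv(1) l]
        using l H Z by (intro sum.cong) (auto simp: re_mat_def algebra_simps)
      also have "\<dots> = (H *\<^sub>v u - (c \<cdot>\<^sub>v (Z *\<^sub>v u) + cnj c \<cdot>\<^sub>v (mat_adjoint Z *\<^sub>v u))) $ l"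
        using l H Z mult_mat_vec_index_sum[OF H uv(1) l] mult_mat_vec_index_sum[OF Z uv(1) l]
          mult_mat_vec_index_sum[OF Zc uv(1) l]
        by (simp add: sum_subtractf sum.distrib sum_distrib_left del: index_mult_mat_vec mat_adjoint_index)
      finally show "((H - 2 \<cdot>\<^sub>m re_mat (c \<cdot>\<^sub>m Z)) *\<^sub>v u) $ l = \<dots>" .
    qed (use H Z in \<open>auto simp: re_mat_def\<close>)
    then have "((H - 2 \<cdot>\<^sub>m re_mat (c \<cdot>\<^sub>m Z)) *\<^sub>v u) \<bullet>c v =
      (H *\<^sub>v u) \<bullet>c v - (c * ((Z *\<^sub>v u) \<bullet>c v) + cnj c * ((mat_adjoint Z *\<^sub>v u) \<bullet>c v))"
      using mult_mat_vec_carrier[OF H uv(1)] mult_mat_vec_carrier[OF Z uv(1)]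
        mult_mat_vec_carrier[OF Zc uv(1)] uv(2) by (simp add: minus_scalar_prod_distrib[of _ k] add_scalar_prod_distrib[of _ k])
    then show "(mat_adjoint U * (H - 2 \<cdot>\<^sub>m re_mat (c \<cdot>\<^sub>m Z)) * U) $$ (i, j) =
      mat_diag k (\<lambda>j. complex_of_real (h j - 2 * Re (c * z j))) $$ (i, j)"
      unfolding ix[OF X] Hu Zu Zu' using ij by (auto simp: mat_diag_def complex_eq_iff)
  qed (use Uc in \<open>auto simp: mat_diag_def\<close>)
qed

section \<open>Ellipses and their support functions\<close>

text \<open>A point outside \<open>K\<close> would be strictly separated from \<open>K\<close>; up
  to a positive factor every nonzero real functional on the plane is
  \<open>Im (cis (- \<theta>) * w)\<close> for some \<open>\<theta>\<close>, so the separation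
  contradicts \<open>supp\<close>.\<close>

lemma subset_closed_convex_by_support:
  fixes K S :: "complex set"
  assumes K: "closed K" "convex K"
    and supp: "\<And>\<theta> w. w \<in> S \<Longrightarrow> \<exists>v\<in>K. Im (cis (- \<theta>) * w) \<le> Im (cis (- \<theta>) * v)"
  shows "S \<subseteq> K"
proof
  fix w assume w: "w \<in> S"
  show "w \<in> K"
  proof (rule ccontr)
    assume "w \<notin> K"
    then obtain a b where ab: "inner a w < b" "\<And>x. x \<in> K \<Longrightarrow> b < inner a x"
      using separating_hyperplane_closed_point[OF K(2,1)] by blast
    obtain v0 where "v0 \<in> K" using supp[OF w] by blast
    then have a0: "a \<noteq> 0" using ab by force
    \<comment> \<open>Multiplication by \<open>- \<i>\<close> turns the real part of
      \<open>cnj a * x\<close>, which is \<open>inner a x\<close>, into an imaginary part with the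
      sign reversed.\<close>
    define u where "u = - \<i> * cnj a / cmod a"
    have "cmod u = 1" using a0 by (simp add: u_def norm_mult norm_divide)
    then have u: "u = cis (- (- Arg u))" using cis_Arg[of u] by (cases "u = 0") (auto simp: sgn_eq)
    have Im_u: "Im (u * x) = - inner a x / cmod a" for x
      by (simp add: u_def inner_complex_def diff_divide_distrib add_divide_distrib)
    obtain v where v: "v \<in> K" "Im (u * w) \<le> Im (u * v)"
      using supp[OF w, of "- Arg u"] u by metis
    then have "inner a v \<le> inner a w" using a0 unfolding Im_u by (simp add: divide_le_cancel)
    with ab v show False by fastforce
  qed
qed

text \<open>As a real-affine image of the closed unit disc, the region inherits compactness and
  convexity.\<close>

lemma ellipse_axes_image:
  assumes "ellipse_axes E c d a b"
  shows "E = (\<lambda>\<xi>. c + d * Complex (a * Re \<xi>) (b * Im \<xi>)) ` cball 0 1"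
proof -
  have E: "E = {c + d * Complex (a * x) (b * y) | x y. x\<^sup>2 + y\<^sup>2 \<le> 1}"
    using assms by (simp add: ellipse_axes_def)
  have ball: "\<xi> \<in> cball 0 1 \<longleftrightarrow> (Re \<xi>)\<^sup>2 + (Im \<xi>)\<^sup>2 \<le> 1" for \<xi> :: complex
    by (simp add: cmod_def)
  show ?thesis
  proof (intro Set.set_eqI iffI)
    fix w assume "w \<in> E"
    then obtain x y where "w = c + d * Complex (a * x) (b * y)" "x\<^sup>2 + y\<^sup>2 \<le> 1"
      unfolding E by blast
    then show "w \<in> (\<lambda>\<xi>. c + d * Complex (a * Re \<xi>) (b * Im \<xi>)) ` cball 0 1"
      by (intro image_eqI[of _ _ "Complex x y"]) (simp_all only: ball complex.sel)
  next
    fix w assume "w \<in> (\<lambda>\<xi>. c + d * Complex (a * Re \<xi>) (b * Im \<xi>)) ` cball 0 1"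
    then show "w \<in> E" unfolding E using ball by blast
  qed
qed

lemma ellipse_compact_convex:
  assumes "is_ellipse E"
  shows "compact E" "convex E" "E \<noteq> {}"
proof -
  obtain c d a b where "ellipse_axes E c d a b" using assms by (auto simp: is_ellipse_def)
  note E = ellipse_axes_image[OF this]
  have Cx: "Complex (a * Re \<xi>) (b * Im \<xi>) = of_real a * of_real (Re \<xi>) + \<i> * (of_real b * of_real (Im \<xi>))" for \<xi>
    by (simp add: complex_eq_iff)
  show "compact E" unfolding E Cx
    by (intro compact_continuous_image continuous_intros) auto
  have "linear (\<lambda>\<xi>. d * Complex (a * Re \<xi>) (b * Im \<xi>))"
    by (rule linearI) (auto simp: complex_eq_iff algebra_simps)
  then have "convex ((\<lambda>w. c + w) ` (\<lambda>\<xi>. d * Complex (a * Re \<xi>) (b * Im \<xi>)) ` cball 0 1)"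
    by (intro convex_translation convex_linear_image) auto
  then show "convex E" unfolding E image_image .
  show "E \<noteq> {}" unfolding E by auto
qed

text \<open>In disc coordinates the height is the functional \<open>p * x + q * y\<close>, whose
  extreme values on the unit disc are plus and minus the length of \<open>(p, q)\<close>, by
  Cauchy-Schwarz.\<close>

lemma ellipse_axes_support:
  fixes \<theta> :: real
  assumes E: "ellipse_axes E c d a b"
  defines "r \<equiv> sqrt ((a * Im (cis (- \<theta>) * d))\<^sup>2 + (b * Re (cis (- \<theta>) * d))\<^sup>2)"
  shows "\<And>w. w \<in> E \<Longrightarrow> \<bar>Im (cis (- \<theta>) * (w - c))\<bar> \<le> r"
    and "\<exists>w\<in>E. Im (cis (- \<theta>) * (w - c)) = r" and "\<exists>w\<in>E. Im (cis (- \<theta>) * (w - c)) = - r"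
proof -
  define p q where "p = a * Im (cis (- \<theta>) * d)" and "q = b * Re (cis (- \<theta>) * d)"
  have r: "r = cmod (Complex p q)" by (simp add: r_def p_def q_def cmod_def)
  have Im_eq: "Im (cis (- \<theta>) * (c + d * Complex (a * x) (b * y) - c)) = p * x + q * y" for x y
    by (simp add: p_def q_def algebra_simps)
  have Eeq: "E = {c + d * Complex (a * x) (b * y) | x y. x\<^sup>2 + y\<^sup>2 \<le> 1}"
    using E by (simp add: ellipse_axes_def)
  show "\<bar>Im (cis (- \<theta>) * (w - c))\<bar> \<le> r" if w: "w \<in> E" for w
  proof -
    obtain x y where xy: "w = c + d * Complex (a * x) (b * y)" "x\<^sup>2 + y\<^sup>2 \<le> 1"
      using w unfolding Eeq by blast
    have "\<bar>inner (Complex p q) (Complex x y)\<bar> \<le> cmod (Complex p q) * cmod (Complex x y)"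
      by (rule Cauchy_Schwarz_ineq2)
    also have "\<dots> \<le> r * 1"
      unfolding r using xy(2) by (intro mult_left_mono) (auto simp: cmod_def)
    finally show ?thesis unfolding xy(1) Im_eq by (simp add: inner_complex_def)
  qed
  \<comment> \<open>The sign \<open>s\<close> treats both extremes at once. The witness is
    \<open>s\<close> times the unit vector along \<open>(p, q)\<close>, or the center if that vector
    is zero.\<close>
  have ex: "\<exists>w\<in>E. Im (cis (- \<theta>) * (w - c)) = s * r" if s: "s\<^sup>2 = 1" for s
  proof (cases "r = 0")
    case True
    have "c + d * Complex (a * 0) (b * 0) \<in> E" unfolding Eeq by (intro CollectI exI[of _ 0]) simp
    then show ?thesis using Im_eq[of 0 0] True by force
  next
    case False
    have pq: "p\<^sup>2 + q\<^sup>2 = r\<^sup>2" unfolding r by (simp add: cmod_def)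
    have "(s * p / r)\<^sup>2 + (s * q / r)\<^sup>2 = (p\<^sup>2 + q\<^sup>2) / r\<^sup>2"
      using s by (simp add: power_mult_distrib power_divide add_divide_distrib)
    then have le: "(s * p / r)\<^sup>2 + (s * q / r)\<^sup>2 \<le> 1" using pq False by simp
    have "p * (s * p / r) + q * (s * q / r) = s * (p\<^sup>2 + q\<^sup>2) / r"
      by (simp add: power2_eq_square algebra_simps add_divide_distrib)
    also have "\<dots> = s * r" unfolding pq using False by (simp add: power2_eq_square)
    finally show ?thesis using le Im_eq[of "s * p / r" "s * q / r"]
      by (intro bexI[of _ "c + d * Complex (a * (s * p / r)) (b * (s * q / r))"])
        (simp, unfold Eeq, blast)
  qed
  show "\<exists>w\<in>E. Im (cis (- \<theta>) * (w - c)) = r" using ex[of 1] by simp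
  show "\<exists>w\<in>E. Im (cis (- \<theta>) * (w - c)) = - r" using ex[of "- 1"] by simp
qed

text \<open>The maximal height over the compact set \<open>E\<close> is a tangent height, hence plus
  or minus \<open>lambda_of\<close>. The nonnegative value is itself attained, so it is the
  maximum.\<close>

lemma associated_ellipse_support:
  assumes E: "associated_ellipse c \<gamma> \<mu> E" and nonneg: "0 \<le> lambda_of \<gamma> \<mu> \<theta>"
  shows "\<And>w. w \<in> E \<Longrightarrow> Im (cis (- \<theta>) * (w - c)) \<le> lambda_of \<gamma> \<mu> \<theta>"
    and "\<exists>w\<in>E. Im (cis (- \<theta>) * (w - c)) = lambda_of \<gamma> \<mu> \<theta>"
proof -
  let ?l = "lambda_of \<gamma> \<mu> \<theta>"
  define f where "f w = Im (cis (- \<theta>) * (w - c))" for w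
  have ell: "is_ellipse E" and tan: "\<And>s. tangent_line ((\<lambda>w. w - c) ` E) \<theta> s \<longleftrightarrow> s = ?l \<or> s = - ?l"
    using E by (auto simp: associated_ellipse_def)
  have tan': "tangent_line ((\<lambda>w. w - c) ` E) \<theta> s \<longleftrightarrow>
    (\<exists>w\<in>E. f w = s) \<and> ((\<forall>w\<in>E. f w \<le> s) \<or> (\<forall>w\<in>E. s \<le> f w))" for s
    by (simp add: tangent_line_def f_def)
  have "continuous_on E f" unfolding f_def by (intro continuous_intros)
  then obtain w where w: "w \<in> E" "\<And>v. v \<in> E \<Longrightarrow> f v \<le> f w"
    using continuous_attains_sup[of E f] ellipse_compact_convex[OF ell] by blast
  have "f w = ?l \<or> f w = - ?l" using w tan[of "f w"] tan'[of "f w"] by blast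
  moreover obtain v where "v \<in> E" "f v = ?l" using tan[of ?l] tan'[of ?l] by blast
  ultimately have "f w = ?l" using w(2)[of v] nonneg by auto
  with w show "\<And>w. w \<in> E \<Longrightarrow> f w \<le> ?l" "\<exists>w\<in>E. f w = ?l" by auto
qed

text \<open>Both sets are closed and convex and have the same support function.\<close>

lemma associated_ellipse_unique:
  assumes "\<And>\<theta>. 0 \<le> lambda_of \<gamma> \<mu> \<theta>"
    and "associated_ellipse c \<gamma> \<mu> E" "associated_ellipse c \<gamma> \<mu> E'"
  shows "E = E'"
proof -
  have "F \<subseteq> F'" if F: "associated_ellipse c \<gamma> \<mu> F" "associated_ellipse c \<gamma> \<mu> F'" for F F'
  proof (rule subset_closed_convex_by_support)
    have "is_ellipse F'" using F by (simp add: associated_ellipse_def)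
    then show "closed F'" "convex F'" using ellipse_compact_convex compact_imp_closed by auto
    fix \<theta> w assume "w \<in> F"
    then have "Im (cis (- \<theta>) * (w - c)) \<le> lambda_of \<gamma> \<mu> \<theta>"
      by (rule associated_ellipse_support(1)[OF F(1) assms(1)])
    moreover obtain v where "v \<in> F'" "Im (cis (- \<theta>) * (v - c)) = lambda_of \<gamma> \<mu> \<theta>"
      using associated_ellipse_support(2)[OF F(2) assms(1)] by blast
    ultimately show "\<exists>v\<in>F'. Im (cis (- \<theta>) * w) \<le> Im (cis (- \<theta>) * v)"
      by (intro bexI[of _ v]) (simp_all add: right_diff_distrib)
  qed
  with assms(2,3) show ?thesis by blast
qed

section \<open>The associated ellipse in closed form\<close>

text \<open>The direction is \<open>- s / cmod s\<close> for the chosen square root \<open>s\<close>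
  of \<open>\<gamma>\<^sup>2 + z\<close>, and squaring removes the sign. The product form also
  covers \<open>\<gamma>\<^sup>2 + z = 0\<close>.\<close>

lemma axis_angle_square:
  "(\<i> * cis (axis_angle \<gamma> z))\<^sup>2 * complex_of_real (cmod (\<gamma>\<^sup>2 + z)) = \<gamma>\<^sup>2 + z"
proof (cases "\<gamma>\<^sup>2 + z = 0")
  case False
  define s where "s = csqrt (\<gamma>\<^sup>2 + z)"
  have s: "s\<^sup>2 = \<gamma>\<^sup>2 + z" "s \<noteq> 0" using False by (auto simp: s_def)
  have "cis (axis_angle \<gamma> z) = sgn (\<i> * s)"
    unfolding axis_angle_def s_def[symmetric] using s(2) by (intro cis_Arg) auto
  then have "\<i> * cis (axis_angle \<gamma> z) = - s / cmod s"
    by (simp add: sgn_eq norm_mult)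
  then show ?thesis
    unfolding s(1)[symmetric] using s(2) by (simp add: power_divide norm_power)
qed (simp add: axis_angle_def)

text \<open>The square of \<open>Im u\<close> is half of
  \<open>(cmod u)\<^sup>2 - Re (u\<^sup>2)\<close>. For
  \<open>u = cis (- \<theta>) * \<gamma>\<close> this carries the factor
  \<open>cis (- 2 * \<theta>)\<close> as the term in \<open>z\<close> does, so both merge into
  \<open>\<gamma>\<^sup>2 + z\<close>.\<close>

lemma lambda_of_pencil:
  fixes \<gamma> z :: complex and h \<theta> :: real
  shows "(Im (cis (- \<theta>) * \<gamma>))\<^sup>2 + (h - 2 * Re (cis (- 2 * \<theta>) * z)) / 4 =
    (cmod \<gamma>)\<^sup>2 / 2 + h / 4 - Re (cis (- 2 * \<theta>) * (\<gamma>\<^sup>2 + z)) / 2"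
proof -
  have sq: "(Im u)\<^sup>2 = ((cmod u)\<^sup>2 - Re (u\<^sup>2)) / 2" for u :: complex
    by (simp add: cmod_power2) (simp add: power2_eq_square)
  have "(cis (- \<theta>) * \<gamma>)\<^sup>2 = cis (- 2 * \<theta>) * \<gamma>\<^sup>2"
    by (simp add: power_mult_distrib Complex.DeMoivre)
  then show ?thesis unfolding sq by (simp add: norm_mult distrib_left add_divide_distrib diff_divide_distrib mult.commute)
qed

lemma associated_ellipse_pencil:
  fixes \<gamma> z c :: complex and h :: real
  defines "a \<equiv> sqrt ((cmod \<gamma>)\<^sup>2 / 2 + h / 4 + cmod (\<gamma>\<^sup>2 + z) / 2)"
    and "b \<equiv> sqrt ((cmod \<gamma>)\<^sup>2 / 2 + h / 4 - cmod (\<gamma>\<^sup>2 + z) / 2)"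
    and "\<mu> \<equiv> (\<lambda>\<theta>. h - 2 * Re (cis (- 2 * \<theta>) * z))"
  assumes nonneg: "\<And>\<theta>. 0 \<le> \<mu> \<theta>"
  shows "\<exists>E. ellipse_axes E c (\<i> * cis (axis_angle \<gamma> z)) a b \<and> associated_ellipse c \<gamma> \<mu> E"
proof -
  define w where "w = \<gamma>\<^sup>2 + z"
  define d where "d = \<i> * cis (axis_angle \<gamma> z)"
  define P where "P = (cmod \<gamma>)\<^sup>2 / 2 + h / 4"
  have lam: "(Im (cis (- \<theta>) * \<gamma>))\<^sup>2 + \<mu> \<theta> / 4 = P - Re (cis (- 2 * \<theta>) * w) / 2" for \<theta>
    unfolding \<mu>_def P_def w_def by (rule lambda_of_pencil)
  \<comment> \<open>The angle \<open>Arg w / 2\<close> minimizes the squared half-width; its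
    nonnegativity there says that the radicand of \<open>b\<close> is nonnegative.\<close>
  have "cis (- 2 * (Arg w / 2)) * w = complex_of_real (cmod w)"
  proof (cases "w = 0")
    case False
    then have "w = cmod w * cis (Arg w)" by (simp add: cis_Arg sgn_eq)
    then have "cis (- Arg w) * w = cmod w * (cis (- Arg w) * cis (Arg w))" by (metis mult.left_commute)
    then show ?thesis by (simp add: cis_mult)
  qed simp
  then have Pw: "0 \<le> P - cmod w / 2"
    using lam[of "Arg w / 2"] nonneg[of "Arg w / 2"] zero_le_power2[of "Im (cis (- (Arg w / 2)) * \<gamma>)"]
    by (simp only: Re_complex_of_real)
  have aP: "a = sqrt (P + cmod w / 2)" and bP: "b = sqrt (P - cmod w / 2)"
    by (simp_all add: a_def b_def P_def w_def)
  have "0 \<le> P + cmod w / 2" using Pw norm_ge_zero[of w] by linarith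
  then have a2: "a\<^sup>2 = P + cmod w / 2" and b2: "b\<^sup>2 = P - cmod w / 2"
    using Pw unfolding aP bP by simp_all
  define E where "E = {c + d * Complex (a * x) (b * y) | x y. x\<^sup>2 + y\<^sup>2 \<le> 1}"
  have ab: "0 \<le> b" "b \<le> a" using Pw by (auto simp: aP bP)
  have ax: "ellipse_axes E c d a b"
    using ab by (simp add: ellipse_axes_def E_def d_def norm_mult)
  have l: "lambda_of \<gamma> \<mu> \<theta> = sqrt ((a * Im (cis (- \<theta>) * d))\<^sup>2 + (b * Re (cis (- \<theta>) * d))\<^sup>2)" for \<theta>
  proof -
    define u where "u = cis (- \<theta>) * d"
    have "cmod u = 1" by (simp add: u_def d_def norm_mult)
    then have u1: "(Re u)\<^sup>2 + (Im u)\<^sup>2 = 1" by (simp add: cmod_def)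
    \<comment> \<open>Relative to the major axis direction \<open>d\<close>, the term in
      \<open>cis (- 2 * \<theta>) * w\<close> becomes a difference of squares. Splitting
      \<open>P\<close> by \<open>u1\<close> then gives the support function of the ellipse.\<close>
    have "u\<^sup>2 * cmod w = cis (- \<theta>) ^ 2 * (d\<^sup>2 * cmod w)" by (simp add: u_def power_mult_distrib)
    also have "\<dots> = cis (- 2 * \<theta>) * w"
      unfolding d_def w_def axis_angle_square by (simp add: Complex.DeMoivre)
    finally have "Re (u\<^sup>2) * cmod w = Re (cis (- 2 * \<theta>) * w)" by (metis Re_complex_of_real mult.commute scaleR_complex.sel(1) scaleR_conv_of_real)
    then have w': "Re (cis (- 2 * \<theta>) * w) = ((Re u)\<^sup>2 - (Im u)\<^sup>2) * cmod w"
      by (simp add: power2_eq_square)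
    have "(a * Im u)\<^sup>2 + (b * Re u)\<^sup>2 = P * ((Re u)\<^sup>2 + (Im u)\<^sup>2) - ((Re u)\<^sup>2 - (Im u)\<^sup>2) * cmod w / 2"
      unfolding power_mult_distrib a2 b2 by (simp add: field_simps)
    then show ?thesis unfolding lambda_of_def lam w' u1 u_def[symmetric] by simp
  qed
  have "tangent_line ((\<lambda>w. w - c) ` E) \<theta> s \<longleftrightarrow> s = lambda_of \<gamma> \<mu> \<theta> \<or> s = - lambda_of \<gamma> \<mu> \<theta>" for \<theta> s
  proof -
    define f where "f w = Im (cis (- \<theta>) * (w - c))" for w
    define r where "r = lambda_of \<gamma> \<mu> \<theta>"
    have "\<bar>f w\<bar> \<le> r" if "w \<in> E" for w
      using ellipse_axes_support(1)[OF ax that, of \<theta>] unfolding f_def r_def l .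
    then have f: "\<And>w. w \<in> E \<Longrightarrow> f w \<le> r" "\<And>w. w \<in> E \<Longrightarrow> - r \<le> f w"
      by (simp_all add: abs_le_iff minus_le_iff)
    obtain w1 w2 where w: "w1 \<in> E" "f w1 = r" "w2 \<in> E" "f w2 = - r"
      using ellipse_axes_support(2,3)[OF ax, of \<theta>] unfolding f_def r_def l by blast
    have "(\<exists>w\<in>E. f w = s) \<and> ((\<forall>w\<in>E. f w \<le> s) \<or> (\<forall>w\<in>E. s \<le> f w)) \<longleftrightarrow> s = r \<or> s = - r"
      using f w by (metis order_antisym)
    then show ?thesis by (simp add: tangent_line_def f_def r_def)
  qed
  then have "associated_ellipse c \<gamma> \<mu> E" using ax by (auto simp: associated_ellipse_def is_ellipse_def)
  with ax show ?thesis unfolding d_def by blast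
qed

section \<open>Convexity and compactness of the numerical range\<close>

text \<open>Sesquilinear expansion; with the identity matrix it also computes norms of
  combinations.\<close>

lemma quadratic_form_combination:
  fixes A :: "complex mat"
  assumes A: "A \<in> carrier_mat n n" and x: "x \<in> carrier_vec n" and y: "y \<in> carrier_vec n"
  shows "(A *\<^sub>v (p \<cdot>\<^sub>v x + q \<cdot>\<^sub>v y)) \<bullet>c (p \<cdot>\<^sub>v x + q \<cdot>\<^sub>v y) =
    p * cnj p * ((A *\<^sub>v x) \<bullet>c x) + p * cnj q * ((A *\<^sub>v x) \<bullet>c y) +
    q * cnj p * ((A *\<^sub>v y) \<bullet>c x) + q * cnj q * ((A *\<^sub>v y) \<bullet>c y)"
proof -
  have Av: "A *\<^sub>v (p \<cdot>\<^sub>v x + q \<cdot>\<^sub>v y) = p \<cdot>\<^sub>v (A *\<^sub>v x) + q \<cdot>\<^sub>v (A *\<^sub>v y)"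
    using A x y by (subst mult_add_distrib_mat_vec[of _ n n]) (auto simp: mult_mat_vec[OF A])
  have Ac: "A *\<^sub>v x \<in> carrier_vec n" "A *\<^sub>v y \<in> carrier_vec n" using A x y by auto
  show ?thesis
    unfolding Av using Ac x y
    by (simp add: conjugate_add_vec[of _ n] conjugate_smult_vec add_scalar_prod_distrib[of _ n]
        scalar_prod_add_distrib[of _ n] algebra_simps)
qed

lemma quadratic_form_smult:
  fixes A :: "complex mat"
  assumes A: "A \<in> carrier_mat n n" and x: "x \<in> carrier_vec n"
  shows "(A *\<^sub>v (p \<cdot>\<^sub>v x)) \<bullet>c (p \<cdot>\<^sub>v x) = p * cnj p * ((A *\<^sub>v x) \<bullet>c x)"
  using assms mult_mat_vec_carrier[OF A x] by (simp add: mult_mat_vec[OF A] conjugate_smult_vec)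

lemma exists_phase:
  fixes u :: complex
  obtains \<omega> where "cmod \<omega> = 1" "Im (\<omega> * u) = 0"
proof (cases "u = 0")
  case False
  have "Im (cnj u / cmod u * u) = 0"
    by (simp add: mult.commute[of "cnj u"] complex_mult_cnj)
  with False that[of "cnj u / cmod u"] show ?thesis by (simp add: norm_divide)
qed (use that[of 1] in simp)

text \<open>Toeplitz--Hausdorff: normalize the values at \<open>y\<close> and \<open>x\<close> to \<open>0\<close> and \<open>1\<close> and multiply \<open>x\<close> by a
  phase \<open>\<omega>\<close> that makes the mixed terms real. Along the path \<open>v \<tau>\<close> from \<open>y\<close> to \<open>\<omega> x\<close> the Rayleigh
  quotient \<open>G\<close> is then real and continuous, and takes every value in \<open>[0, 1]\<close>.\<close>

lemma numerical_range_convex: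
  assumes A: "A \<in> carrier_mat n n"
  shows "convex (numerical_range A)"
proof (rule convexI)
  fix a b :: complex and t' t :: real
  assume "a \<in> numerical_range A" "b \<in> numerical_range A" and t: "0 \<le> t'" "0 \<le> t" "t' + t = 1"
  then obtain x y where x: "x \<in> carrier_vec n" "x \<bullet>c x = 1" "a = (A *\<^sub>v x) \<bullet>c x"
    and y: "y \<in> carrier_vec n" "y \<bullet>c y = 1" "b = (A *\<^sub>v y) \<bullet>c y"
    using A by (auto simp: numerical_range_def)
  show "t' *\<^sub>R a + t *\<^sub>R b \<in> numerical_range A"
  proof (cases "a = b")
    case True
    then have "t' *\<^sub>R a + t *\<^sub>R b = a" using t by (metis scaleR_left.add scaleR_one)
    then show ?thesis using \<open>a \<in> numerical_range A\<close> by simp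
  next
    case False
    \<comment> \<open>\<open>c1\<close> and \<open>c2\<close> are the mixed terms of
      \<open>(A - b I) / (a - b)\<close>, whose form takes the value \<open>1\<close> at
      \<open>x\<close> and \<open>0\<close> at \<open>y\<close>.\<close>
    define c1 where "c1 = ((A *\<^sub>v x) \<bullet>c y - b * (x \<bullet>c y)) / (a - b)"
    define c2 where "c2 = ((A *\<^sub>v y) \<bullet>c x - b * (y \<bullet>c x)) / (a - b)"
    \<comment> \<open>The imaginary part of \<open>\<omega> * c1 + cnj \<omega> * c2\<close> equals
      that of \<open>\<omega> * (c1 - cnj c2)\<close>.\<close>
    obtain \<omega> where w: "cmod \<omega> = 1" "Im (\<omega> * (c1 - cnj c2)) = 0" by (rule exists_phase)
    have ww: "\<omega> * cnj \<omega> = 1" using w(1) by (simp add: complex_mult_cnj cmod_def complex_eq_iff)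
    define R where "R = Re (\<omega> * c1 + cnj \<omega> * c2)"
    have R: "\<omega> * c1 + cnj \<omega> * c2 = complex_of_real R"
      using w(2) unfolding R_def by (simp add: complex_eq_iff algebra_simps)
    define v where "v \<tau> = (complex_of_real \<tau> * \<omega>) \<cdot>\<^sub>v x + complex_of_real (1 - \<tau>) \<cdot>\<^sub>v y" for \<tau>
    have vc: "v \<tau> \<in> carrier_vec n" for \<tau> using x y by (simp add: v_def)
    define N where "N \<tau> = \<tau>\<^sup>2 + (1 - \<tau>)\<^sup>2 + 2 * \<tau> * (1 - \<tau>) * Re (\<omega> * (x \<bullet>c y))" for \<tau>
    have yx: "y \<bullet>c x = cnj (x \<bullet>c y)" by (rule cscalar_prod_commute[OF y(1) x(1)])
    have vv': "v \<tau> \<bullet>c v \<tau> = complex_of_real (\<tau>\<^sup>2) * (\<omega> * cnj \<omega>) + complex_of_real ((1 - \<tau>)\<^sup>2) +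
      complex_of_real (\<tau> * (1 - \<tau>)) * (\<omega> * (x \<bullet>c y) + cnj \<omega> * (y \<bullet>c x))" for \<tau>
      using quadratic_form_combination[OF one_carrier_mat x(1) y(1), of "complex_of_real \<tau> * \<omega>" "complex_of_real (1 - \<tau>)"]
        vc[of \<tau>] x y unfolding v_def[symmetric] by (simp add: power2_eq_square algebra_simps)
    have vv: "v \<tau> \<bullet>c v \<tau> = complex_of_real (N \<tau>)" for \<tau>
      unfolding vv' ww yx N_def by (simp add: complex_eq_iff algebra_simps)
    have Avv': "(A *\<^sub>v v \<tau>) \<bullet>c v \<tau> = complex_of_real (\<tau>\<^sup>2) * (\<omega> * cnj \<omega>) * a + complex_of_real ((1 - \<tau>)\<^sup>2) * b +
      complex_of_real (\<tau> * (1 - \<tau>)) * (\<omega> * ((A *\<^sub>v x) \<bullet>c y) + cnj \<omega> * ((A *\<^sub>v y) \<bullet>c x))" for \<tau>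
      using quadratic_form_combination[OF A x(1) y(1), of "complex_of_real \<tau> * \<omega>" "complex_of_real (1 - \<tau>)"]
      unfolding v_def[symmetric] x(3)[symmetric] y(3)[symmetric] by (simp add: power2_eq_square algebra_simps)
    have Axy: "(A *\<^sub>v x) \<bullet>c y = b * (x \<bullet>c y) + (a - b) * c1" "(A *\<^sub>v y) \<bullet>c x = b * (y \<bullet>c x) + (a - b) * c2"
      using False by (simp_all add: c1_def c2_def)
    have Avv: "(A *\<^sub>v v \<tau>) \<bullet>c v \<tau> = b * complex_of_real (N \<tau>) + (a - b) * complex_of_real (\<tau>\<^sup>2 + \<tau> * (1 - \<tau>) * R)" for \<tau>
      unfolding Avv' vv[symmetric] vv' Axy of_real_add of_real_mult[of "\<tau> * (1 - \<tau>)"] R[symmetric] ww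
      by (simp add: algebra_simps)
    have N0: "N \<tau> > 0" for \<tau>
    proof -
      have "v \<tau> \<noteq> 0\<^sub>v n"
      proof
        assume v0: "v \<tau> = 0\<^sub>v n"
        show False
        proof (cases "\<tau> = 0")
          case True
          then have "v \<tau> = y" using x y by (intro eq_vecI) (auto simp: v_def)
          then show False using v0 y by auto
        next
          case t0: False
          \<comment> \<open>If the path met zero, \<open>x\<close> would be a multiple of
            \<open>y\<close> by a number of modulus one, and the two values \<open>a\<close> and
            \<open>b\<close> would coincide.\<close>
          define q where "q = - complex_of_real (1 - \<tau>) / (complex_of_real \<tau> * \<omega>)"
          have w0: "\<omega> \<noteq> 0" using w(1) by auto
          have xq: "x = q \<cdot>\<^sub>v y"
          proof (rule eq_vecI)
            fix i assume "i < dim_vec (q \<cdot>\<^sub>v y)"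
            then have i: "i < n" using y by simp
            have "v \<tau> $ i = 0" using v0 i by simp
            then show "x $ i = (q \<cdot>\<^sub>v y) $ i"
              using i x y t0 w0 by (simp add: v_def q_def field_simps add_eq_0_iff)
          qed (use x y in auto)
          have "q * cnj q = 1" using x(2) y unfolding xq by (simp add: conjugate_smult_vec mult.commute)
          then have "a = b" using quadratic_form_smult[OF A y(1), of q] unfolding x(3) y(3) xq by simp
          then show False using False by simp
        qed
      qed
      then have "v \<tau> \<bullet>c v \<tau> > 0" using conjugate_square_greater_0_vec[OF vc[of \<tau>]] by blast
      then show ?thesis unfolding vv by (simp add: less_complex_def)
    qed
    define G where "G \<tau> = (\<tau>\<^sup>2 + \<tau> * (1 - \<tau>) * R) / N \<tau>" for \<tau>
    have "continuous_on {0..1} G"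
      unfolding G_def using N0 unfolding N_def by (intro continuous_intros) (metis less_irrefl)
    moreover have "G 0 = 0" "G 1 = 1" by (simp_all add: G_def N_def)
    \<comment> \<open>The weight of \<open>a\<close> is \<open>t'\<close>, and \<open>G\<close> runs
      from \<open>0\<close> (value \<open>b\<close>) to \<open>1\<close> (value
      \<open>a\<close>).\<close>
    ultimately obtain \<tau> where \<tau>: "G \<tau> = t'"
      using IVT'[of G 0 t' 1] t by auto
    define p where "p = complex_of_real (1 / sqrt (N \<tau>))"
    have p: "p * cnj p = complex_of_real (1 / N \<tau>)"
      using N0[of \<tau>] unfolding p_def by (simp flip: of_real_mult)
    have "(p \<cdot>\<^sub>v v \<tau>) \<bullet>c (p \<cdot>\<^sub>v v \<tau>) = p * cnj p * (v \<tau> \<bullet>c v \<tau>)"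
      using vc[of \<tau>] by (simp add: conjugate_smult_vec)
    also have "\<dots> = 1" unfolding p vv using N0[of \<tau>] by (simp flip: of_real_mult)
    finally have unit: "(p \<cdot>\<^sub>v v \<tau>) \<bullet>c (p \<cdot>\<^sub>v v \<tau>) = 1" .
    have "(A *\<^sub>v (p \<cdot>\<^sub>v v \<tau>)) \<bullet>c (p \<cdot>\<^sub>v v \<tau>) =
      b * (complex_of_real (1 / N \<tau>) * complex_of_real (N \<tau>)) +
      (a - b) * (complex_of_real (1 / N \<tau>) * complex_of_real (\<tau>\<^sup>2 + \<tau> * (1 - \<tau>) * R))"
    proof -
      have "r * (b * u + d * s) = b * (r * u) + d * (r * s)" for r u d s :: complex
        by (simp add: algebra_simps)
      then show ?thesis unfolding quadratic_form_smult[OF A vc] p Avv .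
    qed
    also have "\<dots> = b * complex_of_real 1 + (a - b) * complex_of_real (G \<tau>)"
      using N0[of \<tau>] unfolding of_real_mult[symmetric] G_def by simp
    also have "\<dots> = t' *\<^sub>R a + t *\<^sub>R b"
      using t unfolding \<tau> by (simp add: scaleR_conv_of_real algebra_simps flip: of_real_add distrib_left)
    finally show ?thesis
      using unit vc[of \<tau>] A unfolding numerical_range_def by (auto intro!: exI[of _ "p \<cdot>\<^sub>v v \<tau>"])
  qed
qed

text \<open>The type of vectors carries no topology; the unit sphere is replaced by a compact set of
  functions on \<open>nat\<close> in the product topology.\<close>

lemma numerical_range_compact:
  assumes A: "A \<in> carrier_mat n n"
  shows "compact (numerical_range A)"
proof -
  \<comment> \<open>The coordinates of a unit vector lie in the unit disc, and indices from
    \<open>n\<close> on are fixed at \<open>0\<close>; the product of these factors is compact by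
    Tychonoff.\<close>
  define S :: "nat \<Rightarrow> complex set" where "S i = (if i < n then cball 0 1 else {0})" for i
  define q where "q f = (\<Sum>i<n. (\<Sum>j<n. A $$ (i, j) * f j) * cnj (f i))" for f :: "nat \<Rightarrow> complex"
  define F where "F = PiE UNIV S \<inter> {f. (\<Sum>i<n. f i * cnj (f i)) = 1}"
  have "compactin (product_topology (\<lambda>_. euclidean) UNIV) (PiE UNIV S)"
    unfolding compactin_PiE by (auto simp: S_def)
  then have "compact (PiE UNIV S)"
    by (simp add: euclidean_product_topology)
  moreover have "closed {f. (\<Sum>i<n. f i * cnj (f i)) = (1::complex)}"
    by (intro closed_Collect_eq continuous_intros continuous_on_product_coordinates)
  ultimately have "compact F" unfolding F_def by (rule compact_Int_closed)
  then have "compact (q ` F)"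
    by (intro compact_continuous_image) (auto simp: q_def intro!: continuous_intros continuous_on_product_coordinates
        intro: continuous_on_subset)
  moreover have "q ` F = numerical_range A"
  proof (intro Set.set_eqI iffI)
    fix w assume "w \<in> q ` F"
    then obtain f where f: "(\<Sum>i<n. f i * cnj (f i)) = 1" "w = q f" by (auto simp: F_def)
    define x where "x = Matrix.vec n f"
    have xc: "x \<in> carrier_vec n" by (simp add: x_def)
    have "x \<bullet>c x = 1" using f by (subst cscalar_prod_sum[of _ n]) (auto simp: x_def)
    moreover have "(A *\<^sub>v x) $ i = (\<Sum>j<n. A $$ (i, j) * f j)" if "i < n" for i
      unfolding mult_mat_vec_index_sum[OF A xc that] by (simp add: x_def)
    then have "w = (A *\<^sub>v x) \<bullet>c x"
      unfolding f(2) q_def using A xc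
      by (subst cscalar_prod_sum[of _ n]) (auto simp: x_def simp del: index_mult_mat_vec)
    ultimately show "w \<in> numerical_range A" using xc A by (auto simp: numerical_range_def)
  next
    fix w assume "w \<in> numerical_range A"
    then obtain x where x: "x \<in> carrier_vec n" "x \<bullet>c x = 1" "w = (A *\<^sub>v x) \<bullet>c x"
      using A by (auto simp: numerical_range_def)
    define f where "f i = (if i < n then x $ i else 0)" for i
    have s: "(\<Sum>i<n. f i * cnj (f i)) = 1"
      using x(1) unfolding x(2)[symmetric] by (subst cscalar_prod_sum[of _ n]) (auto simp: f_def)
    have "(\<Sum>i<n. (cmod (f i))\<^sup>2) = 1"
    proof -
      have "complex_of_real (\<Sum>i<n. (cmod (f i))\<^sup>2) = 1"
        unfolding s[symmetric] by (simp only: of_real_sum complex_norm_square)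
      then show ?thesis using of_real_eq_1_iff by blast
    qed
    then have "(cmod (f i))\<^sup>2 \<le> 1" if "i < n" for i
      using member_le_sum[of i "{..<n}" "\<lambda>i. (cmod (f i))\<^sup>2"] that by simp
    then have "f \<in> PiE UNIV S"
      by (auto simp: S_def f_def abs_square_le_1 split: if_splits)
    moreover have "(A *\<^sub>v x) $ i = (\<Sum>j<n. A $$ (i, j) * f j)" if "i < n" for i
      unfolding mult_mat_vec_index_sum[OF A x(1) that] by (simp add: f_def)
    then have "w = q f"
      unfolding x(3) q_def using A x(1)
      by (subst cscalar_prod_sum[of _ n]) (auto simp: f_def simp del: index_mult_mat_vec)
    ultimately show "w \<in> q ` F" using s by (auto simp: F_def)
  qed
  ultimately show ?thesis by simp
qed

section \<open>The support function of the numerical range of a block matrix\<close>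

text \<open>\<open>cross_vec C D \<theta>\<close> is \<open>2 * \<i>\<close> times the off-diagonal block of
  \<open>Im (cis (- \<theta>) A)\<close>.\<close>

definition cross_vec :: "complex mat \<Rightarrow> complex mat \<Rightarrow> real \<Rightarrow> complex Matrix.vec \<Rightarrow> complex Matrix.vec" where
  "cross_vec C D \<theta> v = cis (- \<theta>) \<cdot>\<^sub>v (C *\<^sub>v v) - cis \<theta> \<cdot>\<^sub>v (mat_adjoint D *\<^sub>v v)"

lemma conjugate_append_vec:
  "conjugate (x @\<^sub>v y) = conjugate x @\<^sub>v conjugate (y :: complex Matrix.vec)"
  by (rule eq_vecI) auto

lemma cscalar_prod_Cauchy_Schwarz:
  fixes v w :: "complex Matrix.vec"
  assumes v: "v \<in> carrier_vec n" and w: "w \<in> carrier_vec n"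
  shows "cmod (v \<bullet>c w) \<le> sqrt (Re (v \<bullet>c v)) * sqrt (Re (w \<bullet>c w))"
proof -
  have L2: "sqrt (Re (u \<bullet>c u)) = L2_set (\<lambda>i. cmod (u $ i)) {..<n}" if "u \<in> carrier_vec n" for u :: "complex Matrix.vec"
  proof -
    have "u \<bullet>c u = complex_of_real (\<Sum>i<n. (cmod (u $ i))\<^sup>2)"
      using that by (subst cscalar_prod_sum[of _ n]) (simp_all only: of_real_sum complex_norm_square carrier_vecD)
    then show ?thesis by (simp add: L2_set_def)
  qed
  have "cmod (v \<bullet>c w) \<le> (\<Sum>i<n. \<bar>cmod (v $ i)\<bar> * \<bar>cmod (w $ i)\<bar>)"
    using v w by (subst cscalar_prod_sum[of _ n]) (auto simp: norm_mult intro!: sum_norm_le)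
  also have "\<dots> \<le> L2_set (\<lambda>i. cmod (v $ i)) {..<n} * L2_set (\<lambda>i. cmod (w $ i)) {..<n}"
    by (rule L2_set_mult_ineq)
  finally show ?thesis using L2[OF v] L2[OF w] by simp
qed

lemma cscalar_prod_self:
  fixes v :: "complex Matrix.vec"
  shows "v \<bullet>c v = complex_of_real (Re (v \<bullet>c v))" "0 \<le> Re (v \<bullet>c v)"
  using conjugate_square_ge_0_vec[of v] by (auto simp: less_eq_complex_def complex_eq_iff)

lemma smult_mat_mult_vec:
  fixes A :: "complex mat"
  assumes "A \<in> carrier_mat m n" "x \<in> carrier_vec n"
  shows "(c \<cdot>\<^sub>m A) *\<^sub>v x = c \<cdot>\<^sub>v (A *\<^sub>v x)"
  using assms by (intro eq_vecI) auto

section \<open>Quadratic forms of the pencil and of the block matrix\<close>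

context
  fixes m k :: nat and C D H Z :: "complex mat"
  assumes C: "C \<in> carrier_mat m k" and D: "D \<in> carrier_mat k m"
    and H: "H = mat_adjoint C * C + D * mat_adjoint D" and Z: "Z = D * C"
begin

lemma H_carrier: "H \<in> carrier_mat k k" and Z_carrier: "Z \<in> carrier_mat k k"
  using C D by (auto simp: H Z)

lemma pencil_carrier: "H - 2 \<cdot>\<^sub>m re_mat (c \<cdot>\<^sub>m Z) \<in> carrier_mat k k"
  using H_carrier Z_carrier by (auto simp: re_mat_def)

lemma cross_vec_carrier [simp]: "v \<in> carrier_vec k \<Longrightarrow> cross_vec C D \<theta> v \<in> carrier_vec m"
  using mult_mat_vec_carrier[OF C] mult_mat_vec_carrier[OF mat_adjoint_carrier[OF D]]
  unfolding cross_vec_def by auto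

text \<open>Moving one factor across the inner product, \<open>H\<close> yields the squared norms of
  \<open>C *\<^sub>v v\<close> and \<open>mat_adjoint D *\<^sub>v v\<close>, and \<open>Z\<close>
  yields their mixed product.\<close>

lemma pencil_quadratic_form:
  assumes v: "v \<in> carrier_vec k"
  shows "((H - 2 \<cdot>\<^sub>m re_mat (c \<cdot>\<^sub>m Z)) *\<^sub>v v) \<bullet>c v =
    (C *\<^sub>v v) \<bullet>c (C *\<^sub>v v) + (mat_adjoint D *\<^sub>v v) \<bullet>c (mat_adjoint D *\<^sub>v v) -
    (c * ((C *\<^sub>v v) \<bullet>c (mat_adjoint D *\<^sub>v v)) + cnj c * ((mat_adjoint D *\<^sub>v v) \<bullet>c (C *\<^sub>v v)))"
proof -
  let ?C' = "mat_adjoint C" and ?D' = "mat_adjoint D"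
  note C' = mat_adjoint_carrier[OF C] and D' = mat_adjoint_carrier[OF D]
  have Z': "mat_adjoint Z = ?C' * ?D'" unfolding Z by (rule mat_adjoint_mult[OF D C])
  have Cv: "C *\<^sub>v v \<in> carrier_vec m" "?D' *\<^sub>v v \<in> carrier_vec m"
    using mult_mat_vec_carrier[OF C v] mult_mat_vec_carrier[OF D' v] by auto
  have "2 \<cdot>\<^sub>m re_mat (c \<cdot>\<^sub>m Z) = c \<cdot>\<^sub>m Z + cnj c \<cdot>\<^sub>m mat_adjoint Z"
    by (rule eq_matI) (use Z_carrier in \<open>auto simp: re_mat_def mat_adjoint_smult\<close>)
  then have "H - 2 \<cdot>\<^sub>m re_mat (c \<cdot>\<^sub>m Z) = (?C' * C + D * ?D') - (c \<cdot>\<^sub>m (D * C) + cnj c \<cdot>\<^sub>m (?C' * ?D'))"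
    unfolding H Z' by (simp only: Z)
  moreover have "\<dots> *\<^sub>v v = (?C' *\<^sub>v (C *\<^sub>v v) + D *\<^sub>v (?D' *\<^sub>v v)) -
    (c \<cdot>\<^sub>v (D *\<^sub>v (C *\<^sub>v v)) + cnj c \<cdot>\<^sub>v (?C' *\<^sub>v (?D' *\<^sub>v v)))"
  proof -
    have mats: "?C' * C \<in> carrier_mat k k" "D * ?D' \<in> carrier_mat k k" "D * C \<in> carrier_mat k k" "?C' * ?D' \<in> carrier_mat k k"
      using C D by auto
    show ?thesis
      unfolding assoc_mult_mat_vec[OF C' C v, symmetric] assoc_mult_mat_vec[OF D D' v, symmetric]
        assoc_mult_mat_vec[OF D C v, symmetric] assoc_mult_mat_vec[OF C' D' v, symmetric]
      using mats v
      by (simp add: minus_mult_distrib_mat_vec[of _ k k] add_mult_distrib_mat_vec[of _ k k] smult_mat_mult_vec[of _ k k])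
  qed
  ultimately have "((H - 2 \<cdot>\<^sub>m re_mat (c \<cdot>\<^sub>m Z)) *\<^sub>v v) \<bullet>c v =
    (?C' *\<^sub>v (C *\<^sub>v v)) \<bullet>c v + (D *\<^sub>v (?D' *\<^sub>v v)) \<bullet>c v -
    (c * ((D *\<^sub>v (C *\<^sub>v v)) \<bullet>c v) + cnj c * ((?C' *\<^sub>v (?D' *\<^sub>v v)) \<bullet>c v))"
    using v mult_mat_vec_carrier[OF C' Cv(1)] mult_mat_vec_carrier[OF C' Cv(2)]
      mult_mat_vec_carrier[OF D Cv(1)] mult_mat_vec_carrier[OF D Cv(2)]
    by (simp add: minus_scalar_prod_distrib[of _ k] add_scalar_prod_distrib[of _ k])
  then show ?thesis
    by (simp add: cscalar_prod_adjoint[OF C' Cv(1) v] cscalar_prod_adjoint[OF C' Cv(2) v]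
        cscalar_prod_adjoint[OF D Cv(1) v] cscalar_prod_adjoint[OF D Cv(2) v])
qed

text \<open>Expanding the squared norm, the phases \<open>cis (- \<theta>)\<close> and
  \<open>cis \<theta>\<close> cancel in the pure terms and combine to
  \<open>cis (- 2 * \<theta>)\<close> and its conjugate in the mixed ones.\<close>

lemma cross_vec_norm:
  assumes v: "v \<in> carrier_vec k"
  shows "cross_vec C D \<theta> v \<bullet>c cross_vec C D \<theta> v =
    ((H - 2 \<cdot>\<^sub>m re_mat (cis (- 2 * \<theta>) \<cdot>\<^sub>m Z)) *\<^sub>v v) \<bullet>c v"
proof -
  define x y where "x = C *\<^sub>v v" and "y = mat_adjoint D *\<^sub>v v"
  have xy: "x \<in> carrier_vec m" "y \<in> carrier_vec m"
    using mult_mat_vec_carrier[OF C v] mult_mat_vec_carrier[OF mat_adjoint_carrier[OF D] v]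
    by (auto simp: x_def y_def)
  have cv: "cross_vec C D \<theta> v = cis (- \<theta>) \<cdot>\<^sub>v x + (- cis \<theta>) \<cdot>\<^sub>v y"
    unfolding cross_vec_def x_def[symmetric] y_def[symmetric] using xy by (intro eq_vecI) auto
  have "cis (- \<theta>) * cis (- \<theta>) = cis (- 2 * \<theta>)" "cis \<theta> * cis \<theta> = cis (2 * \<theta>)"
    by (simp_all add: cis_mult)
  then show ?thesis
    unfolding cv pencil_quadratic_form[OF v] x_def[symmetric] y_def[symmetric]
    using quadratic_form_combination[OF one_carrier_mat xy, of "cis (- \<theta>)" "- cis \<theta>"] xy
    by (simp add: cis_cnj cis_mult)
qed

lemma block_quadratic_form:
  assumes x: "x \<in> carrier_vec m" "y \<in> carrier_vec k"
  shows "(four_block_mat (\<alpha> \<cdot>\<^sub>m 1\<^sub>m m) C D (\<beta> \<cdot>\<^sub>m 1\<^sub>m k) *\<^sub>v (x @\<^sub>v y)) \<bullet>c (x @\<^sub>v y) =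
    \<alpha> * (x \<bullet>c x) + (C *\<^sub>v y) \<bullet>c x + cnj ((mat_adjoint D *\<^sub>v y) \<bullet>c x) + \<beta> * (y \<bullet>c y)"
proof -
  have Cy: "C *\<^sub>v y \<in> carrier_vec m" and Dx: "D *\<^sub>v x \<in> carrier_vec k"
    and Dy: "mat_adjoint D *\<^sub>v y \<in> carrier_vec m"
    using mult_mat_vec_carrier[OF C x(2)] mult_mat_vec_carrier[OF D x(1)]
      mult_mat_vec_carrier[OF mat_adjoint_carrier[OF D] x(2)] by auto
  have "four_block_mat (\<alpha> \<cdot>\<^sub>m 1\<^sub>m m) C D (\<beta> \<cdot>\<^sub>m 1\<^sub>m k) *\<^sub>v (x @\<^sub>v y) =
    (\<alpha> \<cdot>\<^sub>v x + C *\<^sub>v y) @\<^sub>v (D *\<^sub>v x + \<beta> \<cdot>\<^sub>v y)"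
    using four_block_mat_mult_vec[of "\<alpha> \<cdot>\<^sub>m 1\<^sub>m m" m m C k D k "\<beta> \<cdot>\<^sub>m 1\<^sub>m k" x y] C D x
    by (simp add: smult_mat_mult_vec[of _ m m] smult_mat_mult_vec[of _ k k])
  then have "(four_block_mat (\<alpha> \<cdot>\<^sub>m 1\<^sub>m m) C D (\<beta> \<cdot>\<^sub>m 1\<^sub>m k) *\<^sub>v (x @\<^sub>v y)) \<bullet>c (x @\<^sub>v y) =
    (\<alpha> \<cdot>\<^sub>v x + C *\<^sub>v y) \<bullet>c x + (D *\<^sub>v x + \<beta> \<cdot>\<^sub>v y) \<bullet>c y"
    using scalar_prod_append[of "\<alpha> \<cdot>\<^sub>v x + C *\<^sub>v y" m "D *\<^sub>v x + \<beta> \<cdot>\<^sub>v y" k "conjugate x" "conjugate y"]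
      x Cy Dx by (simp add: conjugate_append_vec)
  also have "\<dots> = \<alpha> * (x \<bullet>c x) + (C *\<^sub>v y) \<bullet>c x + ((D *\<^sub>v x) \<bullet>c y + \<beta> * (y \<bullet>c y))"
    using x Cy Dx by (simp add: add_scalar_prod_distrib[of _ m] add_scalar_prod_distrib[of _ k])
  also have "(D *\<^sub>v x) \<bullet>c y = cnj ((mat_adjoint D *\<^sub>v y) \<bullet>c x)"
    unfolding cscalar_prod_adjoint[OF D x] by (rule cscalar_prod_commute[OF x(1) Dy])
  finally show ?thesis by (simp add: add.assoc)
qed

text \<open>As the weights of \<open>x\<close> and \<open>y\<close> add up to one, subtracting the
  center leaves \<open>(\<alpha> - \<beta>) / 2\<close> times their difference. The conjugated term
  with \<open>D\<close> joins the term with \<open>C\<close> because conjugation reverses the sign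
  of the imaginary part.\<close>

lemma block_support_form:
  assumes x: "x \<in> carrier_vec m" "y \<in> carrier_vec k" and unit: "x \<bullet>c x + y \<bullet>c y = 1"
  shows "Im (cis (- \<theta>) *
      ((four_block_mat (\<alpha> \<cdot>\<^sub>m 1\<^sub>m m) C D (\<beta> \<cdot>\<^sub>m 1\<^sub>m k) *\<^sub>v (x @\<^sub>v y)) \<bullet>c (x @\<^sub>v y) - (\<alpha> + \<beta>) / 2)) =
    Im (cis (- \<theta>) * ((\<alpha> - \<beta>) / 2)) * (Re (x \<bullet>c x) - Re (y \<bullet>c y)) + Im (cross_vec C D \<theta> y \<bullet>c x)"
proof -
  define u v where "u = (C *\<^sub>v y) \<bullet>c x" and "v = (mat_adjoint D *\<^sub>v y) \<bullet>c x"
  have Cy: "C *\<^sub>v y \<in> carrier_vec m" "mat_adjoint D *\<^sub>v y \<in> carrier_vec m"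
    using mult_mat_vec_carrier[OF C x(2)] mult_mat_vec_carrier[OF mat_adjoint_carrier[OF D] x(2)] by auto
  have cross: "cross_vec C D \<theta> y \<bullet>c x = cis (- \<theta>) * u - cis \<theta> * v"
    unfolding cross_vec_def u_def v_def using x Cy by (simp add: minus_scalar_prod_distrib[of _ m])
  define p q where "p = Re (x \<bullet>c x)" and "q = Re (y \<bullet>c y)"
  have pq: "x \<bullet>c x = complex_of_real p" "y \<bullet>c y = complex_of_real q"
    unfolding p_def q_def by (rule cscalar_prod_self(1))+
  have "complex_of_real (p + q) = 1" using unit unfolding pq by simp
  then have q: "q = 1 - p" by (simp only: of_real_eq_1_iff)
  have eq: "\<alpha> * complex_of_real p + u + cnj v + \<beta> * complex_of_real q - (\<alpha> + \<beta>) / 2 =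
    (\<alpha> - \<beta>) / 2 * complex_of_real (p - q) + u + cnj v"
    unfolding q by (simp add: field_simps)
  have Im_eq: "Im (cis (- \<theta>) * (g * complex_of_real r + u + cnj v)) =
    Im (cis (- \<theta>) * g) * r + Im (cis (- \<theta>) * u - cis \<theta> * v)" for g r
    by (simp add: algebra_simps)
  show ?thesis
    unfolding block_quadratic_form[OF x] cross pq u_def[symmetric] v_def[symmetric] Re_complex_of_real eq Im_eq ..
qed

end

section \<open>Bounding and attaining the support function\<close>

text \<open>The left side pairs \<open>(s, sqrt M / 2)\<close> with
  \<open>(p - q, 2 * sqrt (p * q))\<close>, which is a unit vector because
  \<open>p + q = 1\<close>.\<close>

lemma weighted_Cauchy_Schwarz:
  fixes s M p q :: real
  assumes "0 \<le> M" "0 \<le> p" "0 \<le> q" "p + q = 1"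
  shows "s * (p - q) + sqrt (M * q) * sqrt p \<le> sqrt (s\<^sup>2 + M / 4)"
proof -
  define b e where "b = sqrt M / 2" and "e = 2 * (sqrt q * sqrt p)"
  have b2: "b\<^sup>2 = M / 4" using assms by (simp add: b_def power_divide)
  have "e\<^sup>2 = 4 * (q * p)" using assms by (simp add: e_def power_mult_distrib)
  then have "(p - q)\<^sup>2 + e\<^sup>2 = (p + q)\<^sup>2" by (simp add: power2_eq_square algebra_simps)
  then have norm1: "(p - q)\<^sup>2 + e\<^sup>2 = 1" using assms by simp
  \<comment> \<open>Lagrange's identity in the plane.\<close>
  have "(s * (p - q) + b * e)\<^sup>2 = (s\<^sup>2 + b\<^sup>2) * ((p - q)\<^sup>2 + e\<^sup>2) - (s * e - b * (p - q))\<^sup>2"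
    by (simp add: power2_eq_square algebra_simps)
  then have "(s * (p - q) + b * e)\<^sup>2 \<le> s\<^sup>2 + b\<^sup>2" unfolding norm1 by simp
  then have "s * (p - q) + b * e \<le> sqrt (s\<^sup>2 + b\<^sup>2)" by (rule real_le_rsqrt)
  moreover have "b * e = sqrt (M * q) * sqrt p" by (simp add: b_def e_def real_sqrt_mult)
  ultimately show ?thesis by (simp add: b2)
qed

lemma unitary_col:
  assumes U: "unitary_mat k U" and j: "j < k"
  shows "Matrix.col U j \<in> carrier_vec k" "Matrix.col U j \<bullet>c Matrix.col U j = 1"
proof -
  have Uc: "U \<in> carrier_mat k k" and UU: "mat_adjoint U * U = 1\<^sub>m k" using U by (auto simp: unitary_mat_def)
  show c: "Matrix.col U j \<in> carrier_vec k" using Uc j by simp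
  have "(mat_adjoint U * 1\<^sub>m k * U) $$ (j, j) = 1"
    using right_mult_one_mat[OF mat_adjoint_carrier[OF Uc]] UU j by simp
  then show "Matrix.col U j \<bullet>c Matrix.col U j = 1"
    unfolding adjoint_conj_index[OF Uc one_carrier_mat j j] using c by simp
qed

context
  fixes m k :: nat and C D H Z U :: "complex mat" and h :: "nat \<Rightarrow> real" and z :: "nat \<Rightarrow> complex"
  assumes C: "C \<in> carrier_mat m k" and D: "D \<in> carrier_mat k m"
    and H: "H = mat_adjoint C * C + D * mat_adjoint D" and Z: "Z = D * C"
    and UD: "unitarily_diagonalizes k U H Z h z"
begin

lemma cross_vec_col:
  assumes j: "j < k"
  shows "cross_vec C D \<theta> (Matrix.col U j) \<bullet>c cross_vec C D \<theta> (Matrix.col U j) =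
    complex_of_real (h j - 2 * Re (cis (- 2 * \<theta>) * z j))"
proof -
  have U: "unitary_mat k U" "U \<in> carrier_mat k k" using UD by (auto simp: unitarily_diagonalizes_def unitary_mat_def)
  note pc = pencil_carrier[OF C D H Z]
  show ?thesis
    unfolding cross_vec_norm[OF C D H Z unitary_col(1)[OF U(1) j]]
      adjoint_conj_index[OF U(2) pc j j, symmetric]
      unitary_conj_pencil[OF UD H_carrier[OF C D H Z] Z_carrier[OF C D H Z]]
    using j by (simp add: mat_diag_def)
qed

text \<open>By \<open>cross_vec_col\<close> this number is the squared norm of a vector.\<close>

lemma pencil_eigenvalue_nonneg:
  assumes j: "j < k"
  shows "0 \<le> h j - 2 * Re (cis (- 2 * \<theta>) * z j)"
  using cross_vec_col[OF j, of \<theta>] cscalar_prod_self(2)[of "cross_vec C D \<theta> (Matrix.col U j)"]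
  by (simp only: Re_complex_of_real)

text \<open>In the basis of columns of \<open>U\<close> the left side is a weighted sum of the
  eigenvalues of the pencil, and the weights add up to the squared norm of \<open>v\<close>.\<close>

lemma cross_vec_le:
  assumes v: "v \<in> carrier_vec k" and M: "\<And>j. j < k \<Longrightarrow> h j - 2 * Re (cis (- 2 * \<theta>) * z j) \<le> M"
  shows "Re (cross_vec C D \<theta> v \<bullet>c cross_vec C D \<theta> v) \<le> M * Re (v \<bullet>c v)"
proof -
  have U: "unitary_mat k U" "U \<in> carrier_mat k k" "mat_adjoint U * U = 1\<^sub>m k"
    using UD by (auto simp: unitarily_diagonalizes_def unitary_mat_def)
  define w where "w j = (cmod ((mat_adjoint U *\<^sub>v v) $ j))\<^sup>2" for j
  \<comment> \<open>The identity is diagonalized by \<open>U\<close> as well, so the same lemma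
    yields Parseval's identity.\<close>
  have "mat_adjoint U * 1\<^sub>m k * U = mat_diag k (\<lambda>_. 1)"
    using right_mult_one_mat[OF mat_adjoint_carrier[OF U(2)]] U(3) by simp
  from unitary_diagonal_quadratic_form[OF U(1) one_carrier_mat this v]
  have vv: "v \<bullet>c v = complex_of_real (\<Sum>j<k. w j)" using v by (simp add: w_def)
  have "cross_vec C D \<theta> v \<bullet>c cross_vec C D \<theta> v =
    complex_of_real (\<Sum>j<k. (h j - 2 * Re (cis (- 2 * \<theta>) * z j)) * w j)"
    unfolding cross_vec_norm[OF C D H Z v]
      unitary_diagonal_quadratic_form[OF U(1) pencil_carrier[OF C D H Z]
        unitary_conj_pencil[OF UD H_carrier[OF C D H Z] Z_carrier[OF C D H Z]] v] w_def
    by (simp only: of_real_sum of_real_mult)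
  moreover have "(\<Sum>j<k. (h j - 2 * Re (cis (- 2 * \<theta>) * z j)) * w j) \<le> (\<Sum>j<k. M * w j)"
    by (intro sum_mono mult_right_mono M) (auto simp: w_def)
  ultimately show ?thesis unfolding vv by (simp only: Re_complex_of_real sum_distrib_left)
qed

text \<open>Cauchy-Schwarz is used twice: for the cross term in the space of \<open>x\<close>, and
  in the plane for the distribution of weight between \<open>x\<close> and \<open>y\<close>.\<close>

lemma block_support_le:
  assumes x: "x \<in> carrier_vec m" "y \<in> carrier_vec k" and unit: "x \<bullet>c x + y \<bullet>c y = 1"
    and "1 \<le> k" and M: "\<And>j. j < k \<Longrightarrow> h j - 2 * Re (cis (- 2 * \<theta>) * z j) \<le> M"
  shows "Im (cis (- \<theta>) *
      ((four_block_mat (\<alpha> \<cdot>\<^sub>m 1\<^sub>m m) C D (\<beta> \<cdot>\<^sub>m 1\<^sub>m k) *\<^sub>v (x @\<^sub>v y)) \<bullet>c (x @\<^sub>v y) - (\<alpha> + \<beta>) / 2))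
    \<le> sqrt ((Im (cis (- \<theta>) * ((\<alpha> - \<beta>) / 2)))\<^sup>2 + M / 4)"
proof -
  define p q where "p = Re (x \<bullet>c x)" and "q = Re (y \<bullet>c y)"
  have pq: "0 \<le> p" "0 \<le> q" "p + q = 1"
    using cscalar_prod_self(2)[of x] cscalar_prod_self(2)[of y] arg_cong[OF unit, of Re] by (auto simp: p_def q_def)
  have "0 \<le> M" using pencil_eigenvalue_nonneg[of 0 \<theta>] M[of 0] \<open>1 \<le> k\<close> by simp
  have "Im (cross_vec C D \<theta> y \<bullet>c x) \<le> cmod (cross_vec C D \<theta> y \<bullet>c x)"
    using abs_Im_le_cmod[of "cross_vec C D \<theta> y \<bullet>c x"] by linarith
  also have "\<dots> \<le> sqrt (Re (cross_vec C D \<theta> y \<bullet>c cross_vec C D \<theta> y)) * sqrt p"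
    unfolding p_def by (rule cscalar_prod_Cauchy_Schwarz[OF cross_vec_carrier[OF C D H Z x(2)] x(1)])
  also have "\<dots> \<le> sqrt (M * q) * sqrt p"
    using cross_vec_le[OF x(2) M] pq by (intro mult_right_mono) (auto simp: q_def)
  finally show ?thesis
    unfolding block_support_form[OF C D H Z x unit] p_def[symmetric] q_def[symmetric]
    using weighted_Cauchy_Schwarz[OF \<open>0 \<le> M\<close> pq, of "Im (cis (- \<theta>) * ((\<alpha> - \<beta>) / 2))"] by linarith
qed

text \<open>Equality in both inequalities: \<open>y\<close> is a multiple of the eigenvector
  \<open>u\<close>, \<open>x\<close> is a multiple of a unit vector \<open>e\<close> aligned with
  \<open>cross_vec C D \<theta> u\<close>, and the two multiples are chosen optimally.\<close>

lemma block_support_attained: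
  assumes j: "j < k" and "1 \<le> m"
  shows "\<exists>x\<in>carrier_vec m. \<exists>y\<in>carrier_vec k. x \<bullet>c x + y \<bullet>c y = 1 \<and> Im (cis (- \<theta>) *
      ((four_block_mat (\<alpha> \<cdot>\<^sub>m 1\<^sub>m m) C D (\<beta> \<cdot>\<^sub>m 1\<^sub>m k) *\<^sub>v (x @\<^sub>v y)) \<bullet>c (x @\<^sub>v y) - (\<alpha> + \<beta>) / 2))
    = sqrt ((Im (cis (- \<theta>) * ((\<alpha> - \<beta>) / 2)))\<^sup>2 + (h j - 2 * Re (cis (- 2 * \<theta>) * z j)) / 4)"
proof -
  define M where "M = h j - 2 * Re (cis (- 2 * \<theta>) * z j)"
  define s where "s = Im (cis (- \<theta>) * ((\<alpha> - \<beta>) / 2))"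
  define u where "u = Matrix.col U j"
  define v where "v = cross_vec C D \<theta> u"
  have U: "unitary_mat k U" using UD by (simp add: unitarily_diagonalizes_def)
  have u: "u \<in> carrier_vec k" "u \<bullet>c u = 1" unfolding u_def by (rule unitary_col[OF U j])+
  have v: "v \<in> carrier_vec m" unfolding v_def by (rule cross_vec_carrier[OF C D H Z u(1)])
  have M0: "0 \<le> M" unfolding M_def by (rule pencil_eigenvalue_nonneg[OF j])
  have vv: "v \<bullet>c v = complex_of_real M" unfolding v_def u_def M_def by (rule cross_vec_col[OF j])
  \<comment> \<open>The factor \<open>- \<i>\<close> makes the product \<open>v \<bullet>c e\<close>
    purely imaginary, so its whole modulus counts. If \<open>v\<close> is zero any unit vector will
    do, and one exists since \<open>1 \<le> m\<close>.\<close>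
  obtain e where e: "e \<in> carrier_vec m" "e \<bullet>c e = 1" "Im (v \<bullet>c e) = sqrt M"
  proof (cases "M = 0")
    case True
    then have "v = 0\<^sub>v m" using vv v by simp
    then show ?thesis using that[of "unit_vec m 0"] True \<open>1 \<le> m\<close>
      by (simp add: cscalar_prod_sum[of _ m] if_distrib cong: if_cong)
  next
    case False
    define r where "r = sqrt M"
    have r: "r > 0" "r * r = M" using False M0 by (auto simp: r_def)
    define e where "e = (- \<i> / complex_of_real r) \<cdot>\<^sub>v v"
    have "e \<bullet>c e = complex_of_real (M / (r * r))" using v r(1) unfolding e_def
      by (simp add: conjugate_smult_vec vv)
    moreover have "v \<bullet>c e = \<i> * complex_of_real (M / r)" using v unfolding e_def
      by (simp add: conjugate_smult_vec vv)
    moreover have "M / r = r" using r by (simp add: field_simps)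
    ultimately show ?thesis using that[of e] v r False unfolding e_def by (simp add: r_def)
  qed
  \<comment> \<open>Half the polar angle of \<open>(s, sqrt M / 2)\<close>: for
    \<open>p = cos t\<close> and \<open>q = sin t\<close> the vector
    \<open>(p\<^sup>2 - q\<^sup>2, 2 * p * q)\<close> has angle \<open>2 * t\<close> and is parallel
    to it.\<close>
  define t where "t = Arg (Complex s (sqrt M / 2)) / 2"
  define l where "l = sqrt (s\<^sup>2 + M / 4)"
  have l: "l = cmod (Complex s (sqrt M / 2))" using M0 by (simp add: l_def cmod_def power_divide)
  have polar: "Complex s (sqrt M / 2) = complex_of_real l * cis (2 * t)"
  proof (cases "Complex s (sqrt M / 2) = 0")
    case False
    then show ?thesis unfolding t_def l by (simp add: cis_Arg sgn_eq)
  qed (simp add: l)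
  have st: "s = l * cos (2 * t)" "sqrt M / 2 = l * sin (2 * t)"
    using arg_cong[OF polar, of Re] arg_cong[OF polar, of Im] by auto
  define p q where "p = cos t" and "q = sin t"
  define x y where "x = complex_of_real p \<cdot>\<^sub>v e" and "y = complex_of_real q \<cdot>\<^sub>v u"
  have xy: "x \<in> carrier_vec m" "y \<in> carrier_vec k" using e u by (auto simp: x_def y_def)
  have xx: "x \<bullet>c x = complex_of_real (p\<^sup>2)" using e
    by (simp add: x_def conjugate_smult_vec power2_eq_square)
  have yy: "y \<bullet>c y = complex_of_real (q\<^sup>2)" using u
    by (simp add: y_def conjugate_smult_vec power2_eq_square)
  have unit: "x \<bullet>c x + y \<bullet>c y = 1" unfolding xx yy p_def q_def of_real_add[symmetric] by simp
  have "cross_vec C D \<theta> y = complex_of_real q \<cdot>\<^sub>v v"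
    using C D u(1) mult_mat_vec[OF C u(1)] mult_mat_vec[OF mat_adjoint_carrier[OF D] u(1)]
    unfolding v_def cross_vec_def y_def by (intro eq_vecI) (auto simp: algebra_simps)
  then have "cross_vec C D \<theta> y \<bullet>c x = complex_of_real (p * q) * (v \<bullet>c e)"
    using v e by (simp add: x_def conjugate_smult_vec)
  then have cross: "Im (cross_vec C D \<theta> y \<bullet>c x) = p * q * sqrt M" by (simp add: e(3))
  have "s * (p\<^sup>2 - q\<^sup>2) + p * q * sqrt M = s * cos (2 * t) + (sqrt M / 2) * sin (2 * t)"
    by (simp add: p_def q_def cos_double sin_double)
  also have "\<dots> = l * ((cos (2 * t))\<^sup>2 + (sin (2 * t))\<^sup>2)" by (simp only: st distrib_left power2_eq_square mult.assoc)
  also have "\<dots> = l" by simp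
  finally have fin: "s * (p\<^sup>2 - q\<^sup>2) + p * q * sqrt M = l" .
  have "Im (cis (- \<theta>) *
      ((four_block_mat (\<alpha> \<cdot>\<^sub>m 1\<^sub>m m) C D (\<beta> \<cdot>\<^sub>m 1\<^sub>m k) *\<^sub>v (x @\<^sub>v y)) \<bullet>c (x @\<^sub>v y) - (\<alpha> + \<beta>) / 2)) = l"
    unfolding block_support_form[OF C D H Z xy unit] cross s_def[symmetric] xx yy Re_complex_of_real by (rule fin)
  then show ?thesis using xy unit unfolding l_def s_def M_def by blast
qed

text \<open>Both sides are closed and convex, so each inclusion reduces to comparing heights in
  every direction.\<close>

lemma numerical_range_block_eq_hull:
  fixes \<alpha> \<beta> :: complex
  defines "A \<equiv> four_block_mat (\<alpha> \<cdot>\<^sub>m 1\<^sub>m m) C D (\<beta> \<cdot>\<^sub>m 1\<^sub>m k)"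
    and "\<mu> \<equiv> (\<lambda>j \<theta>. h j - 2 * Re (cis (- 2 * \<theta>) * z j))"
  assumes "1 \<le> m" "1 \<le> k"
    and E: "\<And>j. j < k \<Longrightarrow> associated_ellipse ((\<alpha> + \<beta>) / 2) ((\<alpha> - \<beta>) / 2) (\<mu> j) (E j)"
  shows "numerical_range A = convex hull (\<Union>j<k. E j)"
proof
  have A: "A \<in> carrier_mat (m + k) (m + k)" using C D by (auto simp: A_def)
  define c \<gamma> where "c = (\<alpha> + \<beta>) / 2" and "\<gamma> = (\<alpha> - \<beta>) / 2"
  note E = E[folded c_def \<gamma>_def]
  have lam: "lambda_of \<gamma> (\<mu> j) \<theta> = sqrt ((Im (cis (- \<theta>) * \<gamma>))\<^sup>2 + \<mu> j \<theta> / 4)" for j \<theta>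
    by (simp add: lambda_of_def)
  have lam0: "0 \<le> lambda_of \<gamma> (\<mu> j) \<theta>" if "j < k" for j \<theta>
    unfolding lam using pencil_eigenvalue_nonneg[OF that, of \<theta>] by (simp add: \<mu>_def)
  have form: "(A *\<^sub>v (x @\<^sub>v y)) \<bullet>c (x @\<^sub>v y) \<in> numerical_range A"
    if "x \<in> carrier_vec m" "y \<in> carrier_vec k" "x \<bullet>c x + y \<bullet>c y = 1" for x y
  proof -
    have "(x @\<^sub>v y) \<bullet>c (x @\<^sub>v y) = 1"
      using that scalar_prod_append[of x m y k "conjugate x" "conjugate y"] by (simp add: conjugate_append_vec)
    then show ?thesis using A that unfolding numerical_range_def by (auto intro!: exI[of _ "x @\<^sub>v y"])
  qed
  show "convex hull (\<Union>j<k. E j) \<subseteq> numerical_range A"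
  proof (rule hull_minimal)
    show "convex (numerical_range A)" by (rule numerical_range_convex[OF A])
    show "(\<Union>j<k. E j) \<subseteq> numerical_range A"
    proof (rule subset_closed_convex_by_support)
      show "closed (numerical_range A)" by (rule compact_imp_closed[OF numerical_range_compact[OF A]])
      show "convex (numerical_range A)" by (rule numerical_range_convex[OF A])
      fix \<theta> w assume "w \<in> (\<Union>j<k. E j)"
      then obtain j where j: "j < k" "w \<in> E j" by auto
      have le: "Im (cis (- \<theta>) * (w - c)) \<le> lambda_of \<gamma> (\<mu> j) \<theta>"
        by (rule associated_ellipse_support(1)[OF E[OF j(1)] lam0[OF j(1)] j(2)])
      obtain x y where xy: "x \<in> carrier_vec m" "y \<in> carrier_vec k" "x \<bullet>c x + y \<bullet>c y = 1"
        "Im (cis (- \<theta>) * ((A *\<^sub>v (x @\<^sub>v y)) \<bullet>c (x @\<^sub>v y) - c)) = lambda_of \<gamma> (\<mu> j) \<theta>"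
        using block_support_attained[OF j(1) \<open>1 \<le> m\<close>, of \<theta> \<alpha> \<beta>]
        unfolding lambda_of_def A_def c_def \<gamma>_def \<mu>_def by blast
      show "\<exists>v\<in>numerical_range A. Im (cis (- \<theta>) * w) \<le> Im (cis (- \<theta>) * v)"
        using form[OF xy(1-3)] le xy(4) by (intro bexI) (simp_all add: right_diff_distrib)
    qed
  qed
  show "numerical_range A \<subseteq> convex hull (\<Union>j<k. E j)"
  proof (rule subset_closed_convex_by_support)
    have "compact (\<Union>j<k. E j)"
      by (intro compact_UN) (use E ellipse_compact_convex(1) in \<open>auto simp: associated_ellipse_def\<close>)
    then show "closed (convex hull (\<Union>j<k. E j))" by (intro compact_imp_closed compact_convex_hull)
    show "convex (convex hull (\<Union>j<k. E j))" by simp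
    fix \<theta> w assume "w \<in> numerical_range A"
    then obtain X where X: "X \<in> carrier_vec (m + k)" "X \<bullet>c X = 1" "w = (A *\<^sub>v X) \<bullet>c X"
      using A by (auto simp: numerical_range_def)
    define x y where "x = vec_first X m" and "y = vec_last X k"
    have xy: "x \<in> carrier_vec m" "y \<in> carrier_vec k" and Xxy: "X = x @\<^sub>v y"
      using X(1) by (auto simp: x_def y_def)
    have unit: "x \<bullet>c x + y \<bullet>c y = 1"
      using X(2) xy scalar_prod_append[of x m y k "conjugate x" "conjugate y"]
      unfolding Xxy by (simp add: conjugate_append_vec)
    have fin: "finite ((\<lambda>j. \<mu> j \<theta>) ` {..<k})" "(\<lambda>j. \<mu> j \<theta>) ` {..<k} \<noteq> {}"
      using \<open>1 \<le> k\<close> by (auto simp: lessThan_empty_iff)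
    \<comment> \<open>The ellipse that reaches farthest depends on \<open>\<theta>\<close>; the hull
      of the union accommodates every choice.\<close>
    obtain j where j: "j < k" "\<mu> j \<theta> = Max ((\<lambda>j. \<mu> j \<theta>) ` {..<k})"
      using Max_in[OF fin] by auto
    have "\<mu> i \<theta> \<le> \<mu> j \<theta>" if "i < k" for i unfolding j(2) using that fin by (intro Max_ge) auto
    then have le: "Im (cis (- \<theta>) * (w - c)) \<le> lambda_of \<gamma> (\<mu> j) \<theta>"
      using block_support_le[OF xy unit \<open>1 \<le> k\<close>, of \<theta> "\<mu> j \<theta>" \<alpha> \<beta>]
      unfolding X(3) Xxy lambda_of_def A_def c_def \<gamma>_def \<mu>_def by blast
    obtain v where "v \<in> E j" "Im (cis (- \<theta>) * (v - c)) = lambda_of \<gamma> (\<mu> j) \<theta>"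
      using associated_ellipse_support(2)[OF E[OF j(1)] lam0[OF j(1)]] by blast
    moreover have "E j \<subseteq> convex hull (\<Union>j<k. E j)" using j(1) by (meson UN_upper hull_subset lessThan_iff order_trans)
    ultimately show "\<exists>v\<in>convex hull (\<Union>j<k. E j). Im (cis (- \<theta>) * w) \<le> Im (cis (- \<theta>) * v)"
      using le by (intro bexI[of _ v]) (auto simp: right_diff_distrib)
  qed
qed

end

text \<open>The factorization of the characteristic polynomial identifies the
  \<open>\<mu> j \<theta>\<close> as the eigenvalues of the pencil. Unique existence of the
  associated ellipses keeps the final quantification over \<open>E\<close> from being vacuous; some
  \<open>E j\<close> may coincide, which accounts for "at most \<open>k\<close>".\<close>

theorem theorem2:
  fixes n k :: nat and \<alpha> \<beta> \<gamma> :: complex and A C D H Z :: "complex mat"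
  assumes "1 \<le> k" and "k \<le> n - 1"
    and "C \<in> carrier_mat (n - k) k" and "D \<in> carrier_mat k (n - k)"
    and "A = four_block_mat (\<alpha> \<cdot>\<^sub>m 1\<^sub>m (n - k)) C D (\<beta> \<cdot>\<^sub>m 1\<^sub>m k)"
    and "H = mat_adjoint C * C + D * mat_adjoint D"
    and "Z = D * C"
    and "\<gamma> = (\<alpha> - \<beta>) / 2"
    and "normal_mat Z" and "Z * H = H * Z"
  shows "(\<exists>U h z. unitarily_diagonalizes k U H Z h z) \<and>
    (\<forall>U h z. unitarily_diagonalizes k U H Z h z \<longrightarrow>
      (let c = (\<alpha> + \<beta>) / 2;
           \<mu> = (\<lambda>j \<theta>. h j - 2 * Re (cis (- 2 * \<theta>) * z j));
           a = (\<lambda>j. sqrt ((cmod \<gamma>)\<^sup>2 / 2 + h j / 4 + cmod (\<gamma>\<^sup>2 + z j) / 2));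
           b = (\<lambda>j. sqrt ((cmod \<gamma>)\<^sup>2 / 2 + h j / 4 - cmod (\<gamma>\<^sup>2 + z j) / 2));
           \<phi> = (\<lambda>j. axis_angle \<gamma> (z j))
       in (\<forall>\<theta>. char_poly (H - 2 \<cdot>\<^sub>m re_mat (cis (- 2 * \<theta>) \<cdot>\<^sub>m Z)) =
                 (\<Prod>j<k. [:- complex_of_real (\<mu> j \<theta>), 1:])) \<and>
          (\<forall>j<k. \<exists>!E. associated_ellipse c \<gamma> (\<mu> j) E) \<and>
          (\<forall>E. (\<forall>j<k. associated_ellipse c \<gamma> (\<mu> j) (E j)) \<longrightarrow>
             numerical_range A = convex hull (\<Union>j<k. E j) \<and>
             (\<forall>j<k. ellipse_axes (E j) c (\<i> * cis (\<phi> j)) (a j) (b j)))))"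
proof (intro conjI allI impI)
  note C = assms(3) and D = assms(4) and H = assms(6) and Z = assms(7)
  have "mat_adjoint H = H"
    unfolding H mat_adjoint_add[OF mult_carrier_mat[OF mat_adjoint_carrier[OF C] C]
        mult_carrier_mat[OF D mat_adjoint_carrier[OF D]]]
      mat_adjoint_mult[OF mat_adjoint_carrier[OF C] C] mat_adjoint_mult[OF D mat_adjoint_carrier[OF D]]
    by simp
  then show "\<exists>U h z. unitarily_diagonalizes k U H Z h z"
    using simultaneous_unitary_diagonalization[OF H_carrier[OF C D H Z] Z_carrier[OF C D H Z]] assms(9,10) by simp
next
  fix U h z assume UD: "unitarily_diagonalizes k U H Z h z"
  note C = assms(3) and D = assms(4) and H = assms(6) and Z = assms(7)
  define \<mu> where "\<mu> = (\<lambda>j \<theta>. h j - 2 * Re (cis (- 2 * \<theta>) * z j))"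
  define c where "c = (\<alpha> + \<beta>) / 2"
  have U: "unitary_mat k U" using UD by (simp add: unitarily_diagonalizes_def)
  have mu0: "0 \<le> \<mu> j \<theta>" if "j < k" for j \<theta>
    unfolding \<mu>_def by (rule pencil_eigenvalue_nonneg[OF C D H Z UD that])
  have lam0: "0 \<le> lambda_of \<gamma> (\<mu> j) \<theta>" if "j < k" for j \<theta>
    unfolding lambda_of_def using mu0[OF that] by simp
  have char: "char_poly (H - 2 \<cdot>\<^sub>m re_mat (cis (- 2 * \<theta>) \<cdot>\<^sub>m Z)) =
      (\<Prod>j<k. [:- complex_of_real (\<mu> j \<theta>), 1:])" for \<theta>
    unfolding \<mu>_def
    by (rule char_poly_unitary_diagonal[OF U pencil_carrier[OF C D H Z]
        unitary_conj_pencil[OF UD H_carrier[OF C D H Z] Z_carrier[OF C D H Z]]])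
  define a b where "a = (\<lambda>j. sqrt ((cmod \<gamma>)\<^sup>2 / 2 + h j / 4 + cmod (\<gamma>\<^sup>2 + z j) / 2))"
    and "b = (\<lambda>j. sqrt ((cmod \<gamma>)\<^sup>2 / 2 + h j / 4 - cmod (\<gamma>\<^sup>2 + z j) / 2))"
  have ex: "\<exists>E. ellipse_axes E c (\<i> * cis (axis_angle \<gamma> (z j))) (a j) (b j) \<and> associated_ellipse c \<gamma> (\<mu> j) E"
    if "j < k" for j
    unfolding \<mu>_def a_def b_def
    by (rule associated_ellipse_pencil) (use mu0[OF that] in \<open>simp only: \<mu>_def\<close>)
  have uniq: "E = E'" if "j < k" "associated_ellipse c \<gamma> (\<mu> j) E" "associated_ellipse c \<gamma> (\<mu> j) E'" for j E E'
    by (rule associated_ellipse_unique[OF lam0[OF that(1)] that(2,3)])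
  have "\<exists>!E. associated_ellipse c \<gamma> (\<mu> j) E" if "j < k" for j
    using ex[OF that] uniq[OF that] by blast
  moreover have "numerical_range A = convex hull (\<Union>j<k. E j)"
    if "\<forall>j<k. associated_ellipse c \<gamma> (\<mu> j) (E j)" for E
    unfolding assms(5)
    by (rule numerical_range_block_eq_hull[OF C D H Z UD])
      (use assms(1,2) that in \<open>auto simp: c_def \<mu>_def assms(8)\<close>)
  \<comment> \<open>Uniqueness identifies \<open>E j\<close> with the ellipse constructed from the
    explicit axes.\<close>
  moreover have "ellipse_axes (E j) c (\<i> * cis (axis_angle \<gamma> (z j))) (a j) (b j)"
    if "\<forall>j<k. associated_ellipse c \<gamma> (\<mu> j) (E j)" "j < k" for E j
    using ex[OF that(2)] uniq[OF that(2)] that by blast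
  ultimately show "let c = (\<alpha> + \<beta>) / 2;
           \<mu> = (\<lambda>j \<theta>. h j - 2 * Re (cis (- 2 * \<theta>) * z j));
           a = (\<lambda>j. sqrt ((cmod \<gamma>)\<^sup>2 / 2 + h j / 4 + cmod (\<gamma>\<^sup>2 + z j) / 2));
           b = (\<lambda>j. sqrt ((cmod \<gamma>)\<^sup>2 / 2 + h j / 4 - cmod (\<gamma>\<^sup>2 + z j) / 2));
           \<phi> = (\<lambda>j. axis_angle \<gamma> (z j))
       in (\<forall>\<theta>. char_poly (H - 2 \<cdot>\<^sub>m re_mat (cis (- 2 * \<theta>) \<cdot>\<^sub>m Z)) =
                 (\<Prod>j<k. [:- complex_of_real (\<mu> j \<theta>), 1:])) \<and>
          (\<forall>j<k. \<exists>!E. associated_ellipse c \<gamma> (\<mu> j) E) \<and>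
          (\<forall>E. (\<forall>j<k. associated_ellipse c \<gamma> (\<mu> j) (E j)) \<longrightarrow>
             numerical_range A = convex hull (\<Union>j<k. E j) \<and>
             (\<forall>j<k. ellipse_axes (E j) c (\<i> * cis (\<phi> j)) (a j) (b j)))"
    unfolding Let_def c_def[symmetric] \<mu>_def[symmetric] a_def[symmetric] b_def[symmetric]
    using char by blast
qed

end
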